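(* Let $0<\kappa<R$ with $\kappa<2\,\mathrm{argsinh}(1)$, and let $\mu=\mu_{\kappa,R}:\mathbf M\to\mathbb R$ be the associated Moebius function. For every $q\ge1$, with $(\mathbf g,\mathbf n)=((0,2),\dots,(0,2))\in(\mathbb N_0^2)^q$, if $Z=(c_1,\dots,c_q)\in\mathcal M^*_{\mathbf g,\mathbf n}$ (a c-surface all of whose $q$ components are circles), then $$\mu(Z)=\frac{(-1)^{q+1}}{2^q\,q!}\prod_{i=1}^q\mathbb 1_{[0,\kappa]}(\ell(c_i)),$$ where $\ell(c_i)$ is the length of the circle $c_i$.
   Context: c-surfaces. Order pairs in $\mathbb N_0^2$ by: $(g,n)\le(g',n')$ if $2g+n-2<2g'+n'-2$, or if $2g+n-2=2g'+n'-2$ and $g\le g'$. For $q\ge1$, $\mathfrak S^q$ is the set of $(\mathbf g,\mathbf n)=((g_1,n_1),\dots,(g_q,n_q))\in(\mathbb N_0^2\setminus\{(0,0),(0,1),(1,0)\})^q$ with $(g_i,n_i)\le(g_{i+1},n_{i+1})$ for all $1\le i<q$. A c-surface of signature $(\mathbf g,\mathbf n)\in\mathfrak S^q$ is a non-empty space with $q$ connected components $\tau_1,\dots,\tau_q$, labelled from $1$ to $q$, where $\tau_i$ is an oriented circle (a 1d component) if $(g_i,n_i)=(0,2)$, and otherwise $\tau_i$ is a compact oriented surface of genus $g_i$ with $n_i$ boundary components numbered $1,\dots,n_i$ (a 2d component). The boundary $\partial S$ of a c-surface is the union of the boundaries of its 2d components and of its 1d components (a circle is its own boundary). Big moduli space.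 For $2g-2+n>0$, $\mathcal M^*_{g,n}$ is the moduli space of compact connected oriented hyperbolic surfaces of signature $(g,n)$ with $n$ labelled geodesic boundary components of arbitrary positive lengths (no cusps), up to orientation- and label-preserving isometry; $\mathcal M^*_{0,2}\cong\mathbb R_{>0}$ is the space of Riemannian metrics on an oriented circle up to isometry, identified with the length. For $(\mathbf g,\mathbf n)\in\mathfrak S^q$, $\mathcal M^*_{\mathbf g,\mathbf n}=\prod_{i=1}^q\mathcal M^*_{g_i,n_i}$, and $\mathbf M=\bigsqcup_{q\ge1}\bigsqcup_{(\mathbf g,\mathbf n)\in\mathfrak S^q}\mathcal M^*_{\mathbf g,\mathbf n}$. Sub-c-surfaces. A curve is a non-contractible simple closed path; a multicurve is a family of pairwise disjoint curves, no one of which is homotopic to another or to the inverse of another. A sub-c-surface of a c-surface $S$ is a c-surface $S'$ with an injection $\iota:S'\to S$ such that $\iota(\partial S')$ is a multicurve in $S$ and $\iota$ preserves the orientation of the 2d components of $S'$. It is viewed as a subset of $S$ together with extra structure: the numbering of its connected components, the numbering of the boundary components of its 2d components, and the orientation of its 1d components (which may be chosen arbitrarily). For $Z\in\mathbf M$, each sub-c-surface is isotopic to a geodesic one (its boundary, which includes its 1d components, is a geodesic multicurve), and $\mathcal S(Z)$ is the set of geodesic sub-c-surfaces of $Z$, including those equal to $Z$ as a set; two elements are distinct if they differ as sets or in numbering or orientation data. Each $\tau\in\mathcal S(Z)$ with its induced metric defines a class $\bar\tau\in\mathbf M$, and $\mu(\tau):=\mu(\bar\tau)$. Tangles. An element of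 $\mathbf M$ is a $(\kappa,R)$-tangle if it is either a circle of length $\le\kappa$, or a hyperbolic surface of signature $(g,n)$ with $2g-2+n=1$ (pair of pants or once-holed torus) all of whose boundary components have length $\le R$. A tangle in $Z$ is a geodesic sub-c-surface of $Z$ that is a tangle. A subset $E\subset S$ weakly fills a c-surface $S$ if every connected component of $S\setminus E$ is either contractible or an annular region in the 2d part of $S$. (A weakly filling union of sub-c-surfaces must contain all 1d components.) $Z\in\mathbf M$ is a $(\kappa,R)$-derived tangle if it is weakly filled by the union of a countable (possibly finite) family of $(\kappa,R)$-tangles in $Z$; $\mathbf D_{\kappa,R}\subset\mathbf M$ is the set of derived tangles. Moebius function. $\mu=\mu_{\kappa,R}:\mathbf M\to\mathbb R$ is the unique function such that: on each $\mathcal M^*_{\mathbf g,\mathbf n}$ it is invariant under the full diffeomorphism group (possibly permuting boundary components and connected components); $\mu(Z)=0$ for $Z\notin\mathbf D_{\kappa,R}$; and $\sum_{\tau\in\mathcal S(Z)}\mu(\tau)=1$ for every $Z\in\mathbf D_{\kappa,R}$. *)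

theory Defs
  imports "HOL-Analysis.Analysis"
begin

section \<open>The hyperbolic plane\<close>

definition hyp_dist :: "complex \<Rightarrow> complex \<Rightarrow> real" where
  "hyp_dist z w = arcosh (1 + (cmod (z - w))\<^sup>2 / (2 * Im z * Im w))"

text \<open>A closed half-plane of the upper half-plane model; its bounding geodesic is \<open>Re z = 0\<close>.\<close>
definition hyp_half_plane :: "complex set" where
  "hyp_half_plane = {z. Im z > 0 \<and> Re z \<ge> 0}"


section \<open>Curves and multicurves in a topological space\<close>

abbreviation unit_circle :: "complex topology" where
  "unit_circle \<equiv> top_of_set (sphere 0 1)"

definition parametrizes :: "'a topology \<Rightarrow> (complex \<Rightarrow> 'a) \<Rightarrow> 'a set \<Rightarrow> bool" where
  "parametrizes X f C \<longleftrightarrow> embedding_map unit_circle X f \<and> f ` sphere 0 1 = C"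

definition freely_homotopic :: "'a topology \<Rightarrow> (complex \<Rightarrow> 'a) \<Rightarrow> (complex \<Rightarrow> 'a) \<Rightarrow> bool" where
  "freely_homotopic X f g \<longleftrightarrow> homotopic_with (\<lambda>_. True) unit_circle X f g"

definition null_homotopic :: "'a topology \<Rightarrow> (complex \<Rightarrow> 'a) \<Rightarrow> bool" where
  "null_homotopic X f \<longleftrightarrow> (\<exists>a. freely_homotopic X f (\<lambda>_. a))"

text \<open>
  Curves are treated as unoriented subsets. Since all parametrizations \<open>f\<close>, \<open>g\<close> of the two
  curves are considered, no curve is homotopic to another one or to its inverse.
\<close>
definition multicurve :: "'a topology \<Rightarrow> 'a set set \<Rightarrow> bool" where
  "multicurve X \<C> \<longleftrightarrow>
     pairwise disjnt \<C> \<and>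
     (\<forall>C\<in>\<C>. \<exists>f. parametrizes X f C \<and> \<not> null_homotopic X f) \<and>
     (\<forall>C\<in>\<C>. \<forall>C'\<in>\<C>. C \<noteq> C' \<longrightarrow>
        (\<forall>f g. parametrizes X f C \<longrightarrow> parametrizes X g C' \<longrightarrow> \<not> freely_homotopic X f g))"

definition annular :: "'a topology \<Rightarrow> bool" where
  "annular X \<longleftrightarrow>
     (\<exists>I :: real set. is_interval I \<and> interior I \<noteq> {} \<and>
        X homeomorphic_space prod_topology unit_circle (top_of_set I))"

text \<open>
  The genus of a compact surface with boundary \<open>B\<close>: the maximal number of pairwise disjoint
  simple closed curves in its interior that together do not separate it.
\<close>
definition nonseparating_system :: "'a topology \<Rightarrow> 'a set \<Rightarrow> 'a set set \<Rightarrow> bool" where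
  "nonseparating_system X B \<C> \<longleftrightarrow>
     finite \<C> \<and> pairwise disjnt \<C> \<and>
     (\<forall>C\<in>\<C>. (\<exists>f. parametrizes X f C) \<and> C \<inter> B = {}) \<and>
     connected_space (subtopology X (topspace X - \<Union>\<C>))"

definition top_genus :: "'a topology \<Rightarrow> 'a set \<Rightarrow> nat" where
  "top_genus X B = (GREATEST k. \<exists>\<C>. nonseparating_system X B \<C> \<and> card \<C> = k)"


section \<open>Closed geodesics\<close>

text \<open>An \<open>l\<close>-periodic unit speed parametrization of a simple closed geodesic of length \<open>l\<close>.\<close>
definition closed_geodesic :: "('a \<Rightarrow> 'a \<Rightarrow> real) \<Rightarrow> real \<Rightarrow> (real \<Rightarrow> 'a) \<Rightarrow> bool" where
  "closed_geodesic d l \<gamma> \<longleftrightarrow>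
     l > 0 \<and>
     (\<forall>s t. \<gamma> s = \<gamma> t \<longleftrightarrow> (\<exists>k::int. s - t = of_int k * l)) \<and>
     (\<forall>t. \<exists>e>0. \<forall>s s'. \<bar>s - t\<bar> < e \<longrightarrow> \<bar>s' - t\<bar> < e \<longrightarrow> d (\<gamma> s) (\<gamma> s') = \<bar>s - s'\<bar>)"

definition geodesic_length :: "('a \<Rightarrow> 'a \<Rightarrow> real) \<Rightarrow> 'a set \<Rightarrow> real" where
  "geodesic_length d C = (THE l. \<exists>\<gamma>. closed_geodesic d l \<gamma> \<and> range \<gamma> = C)"


section \<open>Metric c-surfaces\<close>

text \<open>
  The points of all spaces are taken from the type \<open>real\<close>, used only as a set with the cardinality
  of the continuum: its metric and topology play no role. Any compact surface or circle,
  and any finite disjoint union of such, has a copy with points in \<open>real\<close>. The Riemannian metrics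
  are represented by their distance functions.

  The orientation of a circle is the class, up to translation of the parameter, of its positively
  oriented unit speed parametrizations. The orientation of a surface is its maximal atlas of
  positively oriented isometric charts. The last argument of \<open>Surface\<close> numbers the boundary
  components.
\<close>
datatype component =
    is_circle: Circle (pts: "real set") (cdist: "real \<Rightarrow> real \<Rightarrow> real")
      (params: "(real \<Rightarrow> real) set")
  | is_surface: Surface (pts: "real set") (cdist: "real \<Rightarrow> real \<Rightarrow> real")
      (charts: "(real set \<times> (real \<Rightarrow> complex)) set") (bdry: "real set list")

type_synonym csurface = "component list"

definition comp_top :: "component \<Rightarrow> real topology" where
  "comp_top C = Metric_space.mtopology (pts C) (cdist C)"

text \<open>The value of the distance outside of the space is fixed, so that it is a function of the
  metric space.\<close>
definition metric_on :: "'a set \<Rightarrow> ('a \<Rightarrow> 'a \<Rightarrow> real) \<Rightarrow> bool" where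
  "metric_on M d \<longleftrightarrow>
     M \<noteq> {} \<and> Metric_space M d \<and> (\<forall>x y. x \<notin> M \<or> y \<notin> M \<longrightarrow> d x y = 0)"

text \<open>On a compact connected space, this says that \<open>d\<close> is the infimum of the lengths of paths,
  i.e. that it is the distance of the Riemannian metric defined by the charts.\<close>
definition length_metric :: "'a set \<Rightarrow> ('a \<Rightarrow> 'a \<Rightarrow> real) \<Rightarrow> bool" where
  "length_metric M d \<longleftrightarrow>
     (\<forall>x\<in>M. \<forall>y\<in>M. \<exists>c :: real \<Rightarrow> 'a. c 0 = x \<and> c (d x y) = y \<and> c ` {0..d x y} \<subseteq> M \<and>
        (\<forall>s\<in>{0..d x y}. \<forall>t\<in>{0..d x y}. d (c s) (c t) = \<bar>s - t\<bar>))"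

subsection \<open>Circles\<close>

text \<open>An isometry from the quotient of the real line by \<open>l\<close> times the integers.\<close>
definition circle_param ::
    "'a set \<Rightarrow> ('a \<Rightarrow> 'a \<Rightarrow> real) \<Rightarrow> real \<Rightarrow> (real \<Rightarrow> 'a) \<Rightarrow> bool" where
  "circle_param M d l \<gamma> \<longleftrightarrow>
     l > 0 \<and> range \<gamma> = M \<and>
     (\<forall>s t. d (\<gamma> s) (\<gamma> t) = infdist (s - t) (range (\<lambda>k::int. of_int k * l)))"

definition metric_circle :: "component \<Rightarrow> bool" where
  "metric_circle C \<longleftrightarrow>
     is_circle C \<and> metric_on (pts C) (cdist C) \<and>
     (\<exists>l \<gamma>. circle_param (pts C) (cdist C) l \<gamma> \<and>
            params C = range (\<lambda>a. \<lambda>t. \<gamma> (t + a)))"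

subsection \<open>Hyperbolic surfaces with geodesic boundary\<close>

definition hyp_chart ::
    "'a set \<Rightarrow> ('a \<Rightarrow> 'a \<Rightarrow> real) \<Rightarrow> 'a set \<times> ('a \<Rightarrow> complex) \<Rightarrow> bool" where
  "hyp_chart M d = (\<lambda>(U, \<phi>).
     openin (Metric_space.mtopology M d) U \<and>
     openin (top_of_set hyp_half_plane) (\<phi> ` U) \<and>
     (\<forall>x\<in>U. \<forall>y\<in>U. hyp_dist (\<phi> x) (\<phi> y) = d x y))"

text \<open>The change of charts is locally an orientation-preserving isometry of the hyperbolic plane.\<close>
definition chart_compat ::
    "'a topology \<Rightarrow> 'a set \<times> ('a \<Rightarrow> complex) \<Rightarrow> 'a set \<times> ('a \<Rightarrow> complex) \<Rightarrow> bool" where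
  "chart_compat X = (\<lambda>(U, \<phi>) (V, \<psi>).
     \<forall>p\<in>U \<inter> V. \<exists>W (a::real) (b::real) (c::real) (e::real).
       openin X W \<and> p \<in> W \<and> a * e - b * c = 1 \<and>
       (\<forall>x\<in>W \<inter> U \<inter> V.
          \<psi> x = (of_real a * \<phi> x + of_real b) / (of_real c * \<phi> x + of_real e)))"

definition hyp_orientation ::
    "'a set \<Rightarrow> ('a \<Rightarrow> 'a \<Rightarrow> real) \<Rightarrow> ('a set \<times> ('a \<Rightarrow> complex)) set \<Rightarrow> bool" where
  "hyp_orientation M d A \<longleftrightarrow>
     (\<Union>(U, \<phi>)\<in>A. U) = M \<and>
     (\<forall>c. c \<in> A \<longleftrightarrow>
        hyp_chart M d c \<and> (\<forall>c'\<in>A. chart_compat (Metric_space.mtopology M d) c c'))"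

definition surf_boundary :: "component \<Rightarrow> real set" where
  "surf_boundary C = {p. \<exists>(U, \<phi>)\<in>charts C. p \<in> U \<and> Re (\<phi> p) = 0}"

fun comp_sig :: "component \<Rightarrow> nat \<times> nat" where
  "comp_sig (Circle M d P) = (0, 2)"
| "comp_sig (Surface M d A bs) =
     (top_genus (comp_top (Surface M d A bs)) (surf_boundary (Surface M d A bs)), length bs)"

definition hyp_surface :: "component \<Rightarrow> bool" where
  "hyp_surface C \<longleftrightarrow>
     is_surface C \<and> metric_on (pts C) (cdist C) \<and>
     compact_space (comp_top C) \<and> connected_space (comp_top C) \<and>
     length_metric (pts C) (cdist C) \<and>
     hyp_orientation (pts C) (cdist C) (charts C) \<and>
     distinct (bdry C) \<and>
     set (bdry C) = connected_components_of (subtopology (comp_top C) (surf_boundary C)) \<and>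
     (case comp_sig C of (g, n) \<Rightarrow> 2 * g + n > 2)"

subsection \<open>c-surfaces\<close>

definition sig_le :: "nat \<times> nat \<Rightarrow> nat \<times> nat \<Rightarrow> bool" where
  "sig_le = (\<lambda>(g, n) (g', n').
     2 * int g + int n - 2 < 2 * int g' + int n' - 2 \<or>
     2 * int g + int n - 2 = 2 * int g' + int n' - 2 \<and> g \<le> g')"

definition signatures :: "nat \<Rightarrow> (nat \<times> nat) list set" where
  "signatures q = {gn. length gn = q \<and>
     set gn \<inter> {(0, 0), (0, 1), (1, 0)} = {} \<and>
     (\<forall>i. Suc i < q \<longrightarrow> sig_le (gn ! i) (gn ! Suc i))}"

definition signature :: "csurface \<Rightarrow> (nat \<times> nat) list" where
  "signature Z = map comp_sig Z"

text \<open>The components are made disjoint, so that the space is the union of its components.\<close>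
definition c_surface :: "csurface \<Rightarrow> bool" where
  "c_surface Z \<longleftrightarrow>
     Z \<noteq> [] \<and>
     (\<forall>C\<in>set Z. metric_circle C \<or> hyp_surface C) \<and>
     (\<forall>i<length Z. \<forall>j<length Z. i \<noteq> j \<longrightarrow> pts (Z ! i) \<inter> pts (Z ! j) = {}) \<and>
     signature Z \<in> signatures (length Z)"

definition points :: "csurface \<Rightarrow> real set" where
  "points Z = (\<Union>C\<in>set Z. pts C)"

text \<open>The topology of the disjoint union.\<close>
definition cs_top :: "csurface \<Rightarrow> real topology" where
  "cs_top Z = topology (\<lambda>U. U \<subseteq> points Z \<and> (\<forall>C\<in>set Z. openin (comp_top C) (U \<inter> pts C)))"

lemma openin_cs_top:
  "openin (cs_top Z) U \<longleftrightarrow> U \<subseteq> points Z \<and> (\<forall>C\<in>set Z. openin (comp_top C) (U \<inter> pts C))"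
proof -
  let ?P = "\<lambda>U. U \<subseteq> points Z \<and> (\<forall>C\<in>set Z. openin (comp_top C) (U \<inter> pts C))"
  have "?P (S \<inter> T)" if S: "?P S" and T: "?P T" for S T
  proof (intro conjI ballI)
    show "S \<inter> T \<subseteq> points Z"
      using S by blast
    fix C assume C: "C \<in> set Z"
    have "openin (comp_top C) (S \<inter> pts C)" "openin (comp_top C) (T \<inter> pts C)"
      using S T C by blast+
    then have "openin (comp_top C) ((S \<inter> pts C) \<inter> (T \<inter> pts C))"
      by (rule openin_Int)
    then show "openin (comp_top C) (S \<inter> T \<inter> pts C)"
      by (simp add: Int_ac)
  qed
  moreover have "?P (\<Union> \<K>)" if K: "\<forall>K\<in>\<K>. ?P K" for \<K>
  proof (intro conjI ballI)
    show "\<Union> \<K> \<subseteq> points Z"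
      using K by blast
    fix C assume "C \<in> set Z"
    then have "openin (comp_top C) (\<Union>K\<in>\<K>. K \<inter> pts C)"
      using K by (intro openin_Union) auto
    then show "openin (comp_top C) (\<Union> \<K> \<inter> pts C)"
      by (simp only: Int_Union2)
  qed
  ultimately have "istopology ?P"
    unfolding istopology_def by (intro conjI[of "\<forall>S T. _ S T"] allI impI)
  from topology_inverse'[OF this] show ?thesis
    unfolding cs_top_def by (rule fun_cong)
qed

text \<open>The components of the boundary; a circle is its own boundary.\<close>
definition boundary_curves :: "csurface \<Rightarrow> real set set" where
  "boundary_curves Z = (\<Union>C\<in>set Z. if is_circle C then {pts C} else set (bdry C))"


section \<open>The big moduli space\<close>

definition comp_isometry :: "(real \<Rightarrow> real) \<Rightarrow> component \<Rightarrow> component \<Rightarrow> bool" where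
  "comp_isometry f C D \<longleftrightarrow>
     bij_betw f (pts C) (pts D) \<and>
     (\<forall>x\<in>pts C. \<forall>y\<in>pts C. cdist D (f x) (f y) = cdist C x y)"

text \<open>An isometry preserving the orientation and the numbering of the boundary.\<close>
definition comp_iso :: "(real \<Rightarrow> real) \<Rightarrow> component \<Rightarrow> component \<Rightarrow> bool" where
  "comp_iso f C D \<longleftrightarrow>
     comp_isometry f C D \<and>
     (is_circle C \<and> is_circle D \<and> params D = (\<lambda>\<gamma>. f \<circ> \<gamma>) ` params C \<or>
      is_surface C \<and> is_surface D \<and>
        (\<forall>U \<phi>. U \<subseteq> pts C \<longrightarrow> ((f ` U, \<phi>) \<in> charts D \<longleftrightarrow> (U, \<phi> \<circ> f) \<in> charts C)) \<and>
        bdry D = map ((`) f) (bdry C))"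

definition cs_iso :: "csurface \<Rightarrow> csurface \<Rightarrow> bool" where
  "cs_iso Z Z' \<longleftrightarrow>
     length Z = length Z' \<and> (\<forall>i<length Z. \<exists>f. comp_iso f (Z ! i) (Z' ! i))"

definition cs_class :: "csurface \<Rightarrow> csurface set" where
  "cs_class Z = {Z'. c_surface Z' \<and> cs_iso Z Z'}"

text \<open>The moduli space \<open>moduli gn\<close> of c-surfaces of signature \<open>gn\<close>.\<close>
definition moduli :: "(nat \<times> nat) list \<Rightarrow> csurface set set" where
  "moduli gn = cs_class ` {Z. c_surface Z \<and> signature Z = gn}"

definition big_moduli :: "csurface set set" where
  "big_moduli = (\<Union>q\<in>{1..}. \<Union>gn\<in>signatures q. moduli gn)"

text \<open>
  Two metrics on the same underlying c-surface are related by a diffeomorphism, which may permute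
  the components and the boundary components and may reverse orientations: there is an
  isometry between them that ignores all this structure.
\<close>
definition diffeo_related :: "csurface \<Rightarrow> csurface \<Rightarrow> bool" where
  "diffeo_related Z Z' \<longleftrightarrow>
     signature Z = signature Z' \<and>
     (\<exists>\<pi>. bij_betw \<pi> {..<length Z} {..<length Z'} \<and>
        (\<forall>i<length Z. \<exists>f. comp_isometry f (Z ! i) (Z' ! \<pi> i)))"


section \<open>Geodesic sub-c-surfaces\<close>

text \<open>
  The component \<open>C\<close> is a subset of \<open>D\<close> whose inclusion is a local isometry. As the distance of \<open>C\<close>
  is a length metric, it is then the one of the induced Riemannian metric; moreover a
  circle \<open>C\<close>, and the geodesic boundary of a surface \<open>C\<close>, are geodesic in \<open>D\<close>. The
  orientation is preserved for a surface and arbitrary for a circle.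
\<close>
definition sub_component :: "component \<Rightarrow> component \<Rightarrow> bool" where
  "sub_component C D \<longleftrightarrow>
     pts C \<subseteq> pts D \<and>
     (\<forall>p\<in>pts C. \<exists>e>0. \<forall>x\<in>pts C. \<forall>y\<in>pts C.
        cdist C p x < e \<longrightarrow> cdist C p y < e \<longrightarrow> cdist D x y = cdist C x y) \<and>
     (is_surface C \<longrightarrow>
        is_surface D \<and> (\<forall>c\<in>charts C. \<forall>c'\<in>charts D. chart_compat (comp_top C) c c'))"

definition sub_csurfaces :: "csurface \<Rightarrow> csurface set" where
  "sub_csurfaces Z = {\<tau>. c_surface \<tau> \<and>
     (\<forall>C\<in>set \<tau>. \<exists>D\<in>set Z. sub_component C D) \<and>
     multicurve (cs_top Z) (boundary_curves \<tau>)}"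


section \<open>Tangles, derived tangles and the Moebius function\<close>

definition is_tangle :: "real \<Rightarrow> real \<Rightarrow> csurface \<Rightarrow> bool" where
  "is_tangle \<kappa> R Z \<longleftrightarrow> c_surface Z \<and>
     (\<exists>C. Z = [C] \<and>
        (is_circle C \<and> geodesic_length (cdist C) (pts C) \<le> \<kappa> \<or>
         is_surface C \<and> (case comp_sig C of (g, n) \<Rightarrow> 2 * int g - 2 + int n = 1) \<and>
           (\<forall>b\<in>set (bdry C). geodesic_length (cdist C) b \<le> R)))"

definition weakly_fills :: "real set \<Rightarrow> csurface \<Rightarrow> bool" where
  "weakly_fills E Z \<longleftrightarrow> E \<subseteq> points Z \<and>
     (\<forall>K\<in>connected_components_of (subtopology (cs_top Z) (points Z - E)).
        contractible_space (subtopology (cs_top Z) K) \<or>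
        K \<subseteq> points (filter is_surface Z) \<and> annular (subtopology (cs_top Z) K))"

definition derived_tangle :: "real \<Rightarrow> real \<Rightarrow> csurface \<Rightarrow> bool" where
  "derived_tangle \<kappa> R Z \<longleftrightarrow> c_surface Z \<and>
     (\<exists>F. countable F \<and> F \<subseteq> {\<tau> \<in> sub_csurfaces Z. is_tangle \<kappa> R \<tau>} \<and>
        weakly_fills (\<Union>\<tau>\<in>F. points \<tau>) Z)"

definition derived_tangles :: "real \<Rightarrow> real \<Rightarrow> csurface set set" where
  "derived_tangles \<kappa> R = cs_class ` {Z. derived_tangle \<kappa> R Z}"

text \<open>
  These conditions determine \<open>\<mu>\<close> on \<open>big_moduli\<close>; its values elsewhere are irrelevant.
  The sum over the possibly infinite set of sub-c-surfaces is unordered.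
\<close>
definition moebius_function :: "real \<Rightarrow> real \<Rightarrow> (csurface set \<Rightarrow> real) \<Rightarrow> bool" where
  "moebius_function \<kappa> R \<mu> \<longleftrightarrow>
     (\<forall>Z Z'. c_surface Z \<longrightarrow> c_surface Z' \<longrightarrow> diffeo_related Z Z' \<longrightarrow>
        \<mu> (cs_class Z) = \<mu> (cs_class Z')) \<and>
     (\<forall>z\<in>big_moduli - derived_tangles \<kappa> R. \<mu> z = 0) \<and>
     (\<forall>Z. c_surface Z \<longrightarrow> cs_class Z \<in> derived_tangles \<kappa> R \<longrightarrow>
        ((\<lambda>\<tau>. \<mu> (cs_class \<tau>)) has_sum 1) (sub_csurfaces Z))"

end

(* A unit speed local isometry from the line into a circle is a parametrization of it up to
   translation and reflection. Hence a circle in a union Z of q circles is a component of Z with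
   one of two orientations, so Z has 2^k q!/(q-k)! sub-c-surfaces with k components, and Z is a
   derived tangle iff all its circles have length at most kappa (a longer one would be a
   non-contractible component of the complement of the tangles). In the latter case, those with
   q components have the same Moebius value as Z, and induction on q turns the sum rule
   into the vanishing of the alternating sum of binomial coefficients. *)
theory Submission
  imports Defs
begin

subsection \<open>Rigidity of circles\<close>

text \<open>A component of a sub-c-surface carries a set, a distance that agrees with the ambient
  one only locally, and an orientation class. All three have to be recovered globally, so rigidity
  is proved for unit speed local isometries of the line, where connectedness propagates the sign and
  the translation of a germ. The multicurve condition involves free homotopies, but a circle is
  clopen in the union: sending the other circles to one of its points retracts the union onto it,
  and a circle is not contractible. The constant \<open>1 / (2 ^ k * fact k)\<close> comes from
  symmetry. The \<open>2 ^ k * fact k\<close> orientations and orders of the same \<open>k\<close>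
  circles share one Moebius value, so they contribute \<open>(- 1) ^ (k + 1)\<close> together, and
  the sum of this over the nonempty subsets of \<open>q\<close> circles is
  \<open>1 - (1 - 1) ^ q\<close>.\<close>

lemma infdist_multiples:
  fixes l x :: real
  assumes "l > 0"
  shows "infdist x (range (\<lambda>k::int. of_int k * l)) = \<bar>x - of_int (round (x / l)) * l\<bar>"
proof (rule antisym)
  show "infdist x (range (\<lambda>k::int. of_int k * l)) \<le> \<bar>x - of_int (round (x / l)) * l\<bar>"
    unfolding dist_real_def[symmetric] by (rule infdist_le) (rule rangeI)
  have "\<bar>x - of_int (round (x / l)) * l\<bar> \<le> \<bar>x - of_int k * l\<bar>" for k :: int
  proof -
    have eq: "\<bar>x - of_int m * l\<bar> = l * \<bar>x / l - of_int m\<bar>" for m :: int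
    proof -
      have "x - of_int m * l = l * (x / l - of_int m)"
        using assms by (simp add: field_simps)
      then show ?thesis
        using assms by (simp add: abs_mult)
    qed
    show ?thesis
      unfolding eq using assms round_diff_minimal[of "x / l" k] by simp
  qed
  then show "\<bar>x - of_int (round (x / l)) * l\<bar> \<le> infdist x (range (\<lambda>k::int. of_int k * l))"
    by (auto simp: infdist_notempty dist_real_def intro!: cINF_greatest)
qed

lemma infdist_multiples_small:
  fixes l x :: real
  assumes "l > 0" "\<bar>x\<bar> < l / 2"
  shows "infdist x (range (\<lambda>k::int. of_int k * l)) = \<bar>x\<bar>"
proof -
  have "\<bar>x / l\<bar> < 1 / 2"
    using assms by (simp add: abs_divide field_simps)
  then have "round (x / l) = 0"
    by (intro round_unique') simp
  then show ?thesis
    using assms by (simp add: infdist_multiples)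
qed

lemma infdist_multiples_le:
  fixes l x :: real
  shows "infdist x (range (\<lambda>k::int. of_int k * l)) \<le> \<bar>x\<bar>"
  using infdist_le[of 0 "range (\<lambda>k::int. of_int k * l)" x] image_eqI[of 0 "\<lambda>k::int. of_int k * l" 0 UNIV]
  by (simp add: dist_real_def)

section \<open>Local isometries from the line into a circle\<close>

context
  fixes M :: "'a set" and d l \<gamma>
  assumes M: "Metric_space M d" and \<gamma>: "circle_param M d l \<gamma>"
begin

lemma circle_param_pos: "l > 0"
  and circle_param_in: "\<gamma> t \<in> M"
  and circle_param_dist: "d (\<gamma> s) (\<gamma> t) = infdist (s - t) (range (\<lambda>k::int. of_int k * l))"
  using \<gamma> by (auto simp: circle_param_def)

lemma circle_param_eq_iff: "\<gamma> s = \<gamma> t \<longleftrightarrow> (\<exists>k::int. s - t = of_int k * l)"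
proof -
  have "\<gamma> s = \<gamma> t \<longleftrightarrow> d (\<gamma> s) (\<gamma> t) = 0"
    using Metric_space.zero[OF M] circle_param_in by metis
  also have "\<dots> \<longleftrightarrow> (\<exists>k::int. s - t = of_int k * l)"
  proof
    assume "d (\<gamma> s) (\<gamma> t) = 0"
    then show "\<exists>k::int. s - t = of_int k * l"
      by (auto simp: circle_param_dist infdist_multiples circle_param_pos)
  next
    assume "\<exists>k::int. s - t = of_int k * l"
    then show "d (\<gamma> s) (\<gamma> t) = 0"
      unfolding circle_param_dist by (metis infdist_zero rangeI)
  qed
  finally show ?thesis .
qed

lemma circle_param_dist_small: "\<bar>s - t\<bar> < l / 2 \<Longrightarrow> d (\<gamma> s) (\<gamma> t) = \<bar>s - t\<bar>"
  by (simp add: circle_param_dist infdist_multiples_small circle_param_pos)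

lemma circle_param_dist_le: "d (\<gamma> s) (\<gamma> t) \<le> \<bar>s - t\<bar>"
  by (simp add: circle_param_dist infdist_multiples_le)

lemma circle_param_minus: "circle_param M d l (\<lambda>t. \<gamma> (- t))"
proof -
  have "range (\<lambda>t. \<gamma> (- t)) = \<gamma> ` range uminus"
    by (simp only: image_image)
  also have "\<dots> = M"
    using \<gamma> by (simp add: circle_param_def)
  finally have range: "range (\<lambda>t. \<gamma> (- t)) = M" .
  have dist: "d (\<gamma> (- s)) (\<gamma> (- t)) = infdist (s - t) (range (\<lambda>k::int. of_int k * l))" for s t
  proof -
    have "d (\<gamma> (- s)) (\<gamma> (- t)) = d (\<gamma> t) (\<gamma> s)"
      by (simp add: circle_param_dist)
    also have "\<dots> = d (\<gamma> s) (\<gamma> t)"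
      by (rule Metric_space.commute[OF M])
    also have "\<dots> = infdist (s - t) (range (\<lambda>k::int. of_int k * l))"
      by (rule circle_param_dist)
    finally show ?thesis .
  qed
  show ?thesis
    unfolding circle_param_def by (intro conjI allI circle_param_pos range dist)
qed

text \<open>Any preimage of \<open>y\<close> can be translated by the multiple of \<open>l\<close>
  nearest to its difference with \<open>b\<close>; for this representative the quotient distance is
  the distance of the parameters.\<close>

lemma circle_param_lift:
  assumes "y \<in> M"
  obtains x where "y = \<gamma> x" "\<bar>x - b\<bar> = d y (\<gamma> b)"
proof -
  obtain z where z: "y = \<gamma> z"
    using \<gamma> assms by (auto simp: circle_param_def)
  define k where "k = round ((z - b) / l)"
  have "\<gamma> (z - of_int k * l) = y"
    unfolding z circle_param_eq_iff by (rule exI[of _ "- k"]) simp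
  moreover have "\<bar>z - of_int k * l - b\<bar> = d y (\<gamma> b)"
    unfolding z circle_param_dist infdist_multiples[OF circle_param_pos] k_def
    by (simp only: diff_diff_eq add.commute)
  ultimately show thesis
    using that by metis
qed

text \<open>Near \<open>t\<close>, each value of \<open>h\<close> has a lift at distance
  \<open>\<bar>s - t\<bar>\<close> from \<open>b\<close>, which leaves two candidates. The distance
  to one further reference point \<open>s0\<close> decides between them, and makes the sign the same
  for all \<open>s\<close>.\<close>

lemma local_isometry_germ:
  assumes h: "\<And>s. h s \<in> M" and e: "e > 0"
    and iso: "\<And>s s'. \<bar>s - t\<bar> < e \<Longrightarrow> \<bar>s' - t\<bar> < e \<Longrightarrow> d (h s) (h s') = \<bar>s - s'\<bar>"
  shows "\<exists>\<sigma>\<in>{1, - 1}. \<exists>a. \<exists>e'>0. \<forall>s. \<bar>s - t\<bar> < e' \<longrightarrow> h s = \<gamma> (\<sigma> * s + a)"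
proof -
  \<comment> \<open>The bound \<open>l / 8\<close> keeps the lifts within \<open>l / 4\<close> of
    one another, where distances on the circle are distances of parameters.\<close>
  define e' where "e' = min e (l / 8)"
  have e': "e' > 0" "e' \<le> e" "e' \<le> l / 8"
    using e circle_param_pos by (auto simp: e'_def)
  obtain b where b: "h t = \<gamma> b"
    using h[of t] \<gamma> by (auto simp: circle_param_def)
  have lift: "\<exists>x. h s = \<gamma> x \<and> \<bar>x - b\<bar> = \<bar>s - t\<bar>" if "\<bar>s - t\<bar> < e'" for s
    using circle_param_lift[OF h, of s b] iso[of s t] that e' e unfolding b
    by (metis abs_zero diff_self less_le_trans)
  define s0 where "s0 = t + e' / 2"
  have s0: "\<bar>s0 - t\<bar> < e'" "s0 - t > 0"
    using e' by (auto simp: s0_def)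
  obtain x0 where x0: "h s0 = \<gamma> x0" "\<bar>x0 - b\<bar> = \<bar>s0 - t\<bar>"
    using lift[OF s0(1)] by blast
  define \<sigma> :: real where "\<sigma> = (if x0 \<ge> b then 1 else - 1)"
  have "h s = \<gamma> (\<sigma> * s + (b - \<sigma> * t))" if s: "\<bar>s - t\<bar> < e'" for s
  proof -
    obtain x where x: "h s = \<gamma> x" "\<bar>x - b\<bar> = \<bar>s - t\<bar>"
      using lift[OF s] by blast
    have "\<bar>x - x0\<bar> < l / 2"
      using x(2) x0(2) s s0 e' by linarith
    then have "\<bar>x - x0\<bar> = \<bar>s - s0\<bar>"
      using circle_param_dist_small[of x x0] iso[of s s0] s s0 e' x(1) x0(1) by auto
    \<comment> \<open>A real number is determined by its distances to two distinct points, here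
      \<open>b\<close> and \<open>x0\<close>.\<close>
    then have "x = \<sigma> * s + (b - \<sigma> * t)"
      using x(2) x0(2) s0 by (auto simp: \<sigma>_def abs_if split: if_splits)
    then show ?thesis
      using x(1) by simp
  qed
  moreover have "\<sigma> \<in> {1, - 1}"
    by (simp add: \<sigma>_def)
  ultimately show ?thesis
    using e' by blast
qed

text \<open>Where the two maps agree, their arguments differ by
  \<open>(\<sigma> - \<sigma>') * s + a - a'\<close>, which has to stay in the discrete set of
  multiples of \<open>l\<close> and hence cannot vary with \<open>s\<close>.\<close>

lemma same_germ_iff:
  assumes \<sigma>: "\<sigma> \<in> {1, - 1}" "\<sigma>' \<in> {1, - 1}"
  shows "eventually (\<lambda>s. \<gamma> (\<sigma> * s + a) = \<gamma> (\<sigma>' * s + a')) (nhds t) \<longleftrightarrow>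
    \<sigma> = \<sigma>' \<and> (\<exists>k::int. a - a' = of_int k * l)"
proof
  assume "eventually (\<lambda>s. \<gamma> (\<sigma> * s + a) = \<gamma> (\<sigma>' * s + a')) (nhds t)"
  then obtain e where e: "e > 0" "\<And>s. \<bar>s - t\<bar> < e \<Longrightarrow> \<gamma> (\<sigma> * s + a) = \<gamma> (\<sigma>' * s + a')"
    by (auto simp: eventually_nhds_metric dist_real_def)
  have *: "\<exists>k::int. (\<sigma> - \<sigma>') * s + a - a' = of_int k * l" if "\<bar>s - t\<bar> < e" for s
    using e(2)[OF that] by (simp add: circle_param_eq_iff algebra_simps)
  have "\<sigma> = \<sigma>'"
  proof (rule ccontr)
    assume ne: "\<sigma> \<noteq> \<sigma>'"
    \<comment> \<open>A shift of \<open>s\<close> by \<delta> changes the difference by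
      \<open>2 * \<delta>\<close> in absolute value, which is positive and at most
      \<open>l / 2\<close>, hence not a multiple of \<open>l\<close>.\<close>
    define \<delta> where "\<delta> = min (e / 2) (l / 4)"
    have \<delta>: "\<delta> > 0" "\<delta> < e" "\<delta> \<le> l / 4"
      using e circle_param_pos by (auto simp: \<delta>_def)
    obtain k k' :: int where k: "(\<sigma> - \<sigma>') * t + a - a' = of_int k * l"
      "(\<sigma> - \<sigma>') * (t + \<delta>) + a - a' = of_int k' * l"
      using *[of t] *[of "t + \<delta>"] \<delta> e by auto
    have eq: "(\<sigma> - \<sigma>') * \<delta> = of_int (k' - k) * l"
      using k by (simp add: algebra_simps)
    have "\<bar>(\<sigma> - \<sigma>') * \<delta>\<bar> = 2 * \<delta>"
      using \<sigma> ne \<delta> by (auto simp: abs_mult)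
    then have "\<bar>of_int (k' - k)\<bar> * l = 2 * \<delta>"
      unfolding eq using circle_param_pos by (simp add: abs_mult)
    then have "0 < \<bar>real_of_int (k' - k)\<bar> * l" "\<bar>real_of_int (k' - k)\<bar> * l < 1 * l"
      using \<delta> circle_param_pos by simp_all
    then have "0 < \<bar>real_of_int (k' - k)\<bar>" "\<bar>real_of_int (k' - k)\<bar> < 1"
      using circle_param_pos by (auto simp: zero_less_mult_iff)
    then show False
      by simp
  qed
  then show "\<sigma> = \<sigma>' \<and> (\<exists>k::int. a - a' = of_int k * l)"
    using *[of t] e by auto
next
  assume "\<sigma> = \<sigma>' \<and> (\<exists>k::int. a - a' = of_int k * l)"
  then show "eventually (\<lambda>s. \<gamma> (\<sigma> * s + a) = \<gamma> (\<sigma>' * s + a')) (nhds t)"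
    by (auto simp: circle_param_eq_iff)
qed

text \<open>The set \<open>G t\<close> of all pairs that describe \<open>h\<close> near
  \<open>t\<close> is locally constant, hence constant on the connected line. The whole set is
  needed because \<open>a\<close> is determined only modulo \<open>l\<close>: a single chosen pair
  might jump.\<close>

lemma local_isometry_rigid:
  assumes h: "\<And>s. h s \<in> M"
    and iso: "\<And>t. \<exists>e>0. \<forall>s s'. \<bar>s - t\<bar> < e \<longrightarrow> \<bar>s' - t\<bar> < e \<longrightarrow> d (h s) (h s') = \<bar>s - s'\<bar>"
  obtains \<sigma> a where "\<sigma> \<in> {1, - 1}" "\<And>t. h t = \<gamma> (\<sigma> * t + a)"
proof -
  define G where "G = (\<lambda>t. {(\<sigma>, a). \<sigma> \<in> {1, - 1} \<and>
    eventually (\<lambda>s. h s = \<gamma> (\<sigma> * s + a)) (nhds t)})"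
  have germ: "\<exists>\<sigma>\<in>{1, - 1}. \<exists>a. eventually (\<lambda>s. h s = \<gamma> (\<sigma> * s + a)) (nhds t)" for t
    using local_isometry_germ[OF h, of _ t] iso[of t]
    by (fastforce simp: eventually_nhds_metric dist_real_def)
  have "G 0 = G t" for t
  proof (rule connected_local_const[of UNIV])
    show "\<forall>t\<in>UNIV. eventually (\<lambda>s. G t = G s) (at t)"
    proof
      fix t
      obtain \<sigma>0 a0 where 0: "\<sigma>0 \<in> {1, - 1}" "eventually (\<lambda>s. h s = \<gamma> (\<sigma>0 * s + a0)) (nhds t)"
        using germ by blast
      \<comment> \<open>One valid pair determines all the others, by a description that does not
        mention the point \<open>s\<close>.\<close>
      have G: "G s = {(\<sigma>, a). \<sigma> = \<sigma>0 \<and> (\<exists>k::int. a0 - a = of_int k * l)}"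
        if s: "eventually (\<lambda>s. h s = \<gamma> (\<sigma>0 * s + a0)) (nhds s)" for s
      proof -
        have "eventually (\<lambda>r. h r = \<gamma> (\<sigma> * r + a)) (nhds s) \<longleftrightarrow>
          \<sigma>0 = \<sigma> \<and> (\<exists>k::int. a0 - a = of_int k * l)" if \<sigma>: "\<sigma> \<in> {1, - 1}" for \<sigma> a
          unfolding same_germ_iff[OF 0(1) \<sigma>, of a0 a s, symmetric]
          by (rule eventually_cong[OF s]) simp
        then have "(\<sigma>, a) \<in> G s \<longleftrightarrow> \<sigma> = \<sigma>0 \<and> (\<exists>k::int. a0 - a = of_int k * l)" for \<sigma> a
          unfolding G_def mem_Collect_eq case_prod_conv
          using 0(1) by (cases "\<sigma> \<in> {1, - 1}") (simp only: simp_thms eq_commute, metis)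
        then show ?thesis
          by (intro set_eqI) (simp only: split_paired_all mem_Collect_eq case_prod_conv)
      qed
      have "eventually (\<lambda>s. eventually (\<lambda>s. h s = \<gamma> (\<sigma>0 * s + a0)) (nhds s)) (nhds t)"
        using 0(2) by (simp add: eventually_eventually)
      then have "eventually (\<lambda>s. G t = G s) (nhds t)"
        by (rule eventually_mono) (simp add: G 0)
      then show "eventually (\<lambda>s. G t = G s) (at t)"
        by (simp add: eventually_at_filter eventually_mono)
    qed
  qed auto
  moreover obtain \<sigma> a where "\<sigma> \<in> {1, - 1}" "eventually (\<lambda>s. h s = \<gamma> (\<sigma> * s + a)) (nhds 0)"
    using germ[of 0] by blast
  then have "(\<sigma>, a) \<in> G 0"
    unfolding G_def mem_Collect_eq case_prod_conv ..
  ultimately have "(\<sigma>, a) \<in> G t" for t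
    by blast
  then have "\<sigma> \<in> {1, - 1}" "h t = \<gamma> (\<sigma> * t + a)" for t
    by (auto simp: G_def dest: eventually_nhds_x_imp_x)
  then show thesis
    using that by blast
qed

lemma circle_param_geodesic: "closed_geodesic d l \<gamma>"
proof -
  have "d (\<gamma> s) (\<gamma> s') = \<bar>s - s'\<bar>" if "\<bar>s - t\<bar> < l / 4" "\<bar>s' - t\<bar> < l / 4" for s s' t
    using that by (intro circle_param_dist_small) linarith
  moreover have "l / 4 > 0"
    using circle_param_pos by simp
  ultimately show ?thesis
    unfolding closed_geodesic_def using circle_param_pos circle_param_eq_iff by blast
qed

text \<open>A closed geodesic is a local isometry, so it is \<gamma> up to sign and translation.
  Comparing the periods then shows that each of the two lengths is an integer multiple of the
  other.\<close>

lemma circle_param_rigid: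
  assumes \<delta>: "closed_geodesic d l' \<delta>" "range \<delta> \<subseteq> M"
  obtains \<sigma> a where "\<sigma> \<in> {1, - 1}" "\<And>t. \<delta> t = \<gamma> (\<sigma> * t + a)" "range \<delta> = M" "l' = l"
proof -
  obtain \<sigma> a where \<sigma>: "\<sigma> \<in> {1, - 1}" and eq: "\<And>t. \<delta> t = \<gamma> (\<sigma> * t + a)"
    using local_isometry_rigid[of \<delta>] \<delta> unfolding closed_geodesic_def by blast
  have "l' > 0"
    using \<delta> by (simp add: closed_geodesic_def)
  have per: "(\<exists>k::int. t = of_int k * l') \<longleftrightarrow> (\<exists>k::int. \<sigma> * t = of_int k * l)" for t
  proof -
    have "(\<exists>k::int. t = of_int k * l') \<longleftrightarrow> \<delta> t = \<delta> 0"
      using \<delta> unfolding closed_geodesic_def by (metis diff_zero)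
    then show ?thesis
      by (simp add: eq circle_param_eq_iff)
  qed
  have "\<exists>k::int. l' = of_int k * l"
  proof -
    have "\<exists>k::int. \<sigma> * l' = of_int k * l"
      using per[of l'] by (metis mult_1 of_int_1)
    then show ?thesis
      using \<sigma> by (metis insertE singletonD minus_mult_minus mult_1 mult_minus_left of_int_minus)
  qed
  moreover have "\<exists>k::int. l = of_int k * l'"
  proof -
    have "\<exists>k::int. \<sigma> * l = of_int k * l"
      using \<sigma> by (auto intro: exI[of _ 1] exI[of _ "-1"])
    then show ?thesis
      using per[of l] by simp
  qed
  ultimately obtain j k :: int where jk: "l' = of_int k * l" "l = of_int j * l'"
    by blast
  have pos: "k > 0" "j > 0"
    using jk \<open>l' > 0\<close> circle_param_pos by (metis of_int_0_less_iff zero_less_mult_pos2)+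
  have "real_of_int (k * j) * l = l"
    using jk by (metis mult.assoc mult.commute of_int_mult)
  then have "k * j = 1"
    using circle_param_pos by (metis less_irrefl mult_cancel_right1 of_int_eq_1_iff)
  then have "l' = l"
    using pos jk by (simp add: zmult_eq_1_iff)
  moreover have "range \<delta> = M"
  proof -
    have "\<gamma> t \<in> range \<delta>" for t
      using eq[of "\<sigma> * (t - a)"] \<sigma> by (auto simp: algebra_simps intro: range_eqI[of _ _ "\<sigma> * (t - a)"])
    then show ?thesis
      using \<gamma> \<delta>(2) by (auto simp: circle_param_def)
  qed
  ultimately show thesis
    using that \<sigma> eq by blast
qed

text \<open>Rigidity supplies the uniqueness required by the definite description in
  \<open>geodesic_length\<close>.\<close>

lemma geodesic_length_circle: "geodesic_length d M = l"
  unfolding geodesic_length_def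
proof (rule the_equality)
  show "\<exists>\<gamma>. closed_geodesic d l \<gamma> \<and> range \<gamma> = M"
    using circle_param_geodesic \<gamma> by (auto simp: circle_param_def)
  show "l' = l" if "\<exists>\<gamma>. closed_geodesic d l' \<gamma> \<and> range \<gamma> = M" for l'
    using that circle_param_rigid by (metis order_refl)
qed

end

subsection \<open>Circle components\<close>

definition flip :: "component \<Rightarrow> component" where
  "flip C = Circle (pts C) (cdist C) ((\<lambda>\<gamma> t. \<gamma> (- t)) ` params C)"

lemma pts_flip [simp]: "pts (flip C) = pts C"
  and cdist_flip [simp]: "cdist (flip C) = cdist C"
  by (simp_all add: flip_def)

lemma metric_circleE:
  assumes "metric_circle C"
  obtains l \<gamma> where "Metric_space (pts C) (cdist C)" "circle_param (pts C) (cdist C) l \<gamma>"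
    "C = Circle (pts C) (cdist C) (range (\<lambda>a t. \<gamma> (t + a)))"
  using assms that unfolding metric_circle_def metric_on_def by (metis component.collapse(1))

lemma metric_circle_is_circle: "metric_circle C \<Longrightarrow> is_circle C"
  by (simp add: metric_circle_def)

lemma metric_circle_nonempty: "metric_circle C \<Longrightarrow> pts C \<noteq> {}"
  by (simp add: metric_circle_def metric_on_def)

lemma flip_Circle:
  "flip (Circle M d (range (\<lambda>a t. \<gamma> (t + a)))) = Circle M d (range (\<lambda>a t. \<gamma> (- t + a)))"
proof -
  have "range (\<lambda>a t. \<gamma> (- t + a)) = (\<lambda>\<gamma> t. \<gamma> (- t)) ` range (\<lambda>a t. \<gamma> (t + a))"
    by (simp add: image_image)
  then show ?thesis
    by (simp add: flip_def)
qed

lemma metric_circle_flip: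
  assumes "metric_circle C"
  shows "metric_circle (flip C)"
proof -
  obtain l \<gamma> where M: "Metric_space (pts C) (cdist C)" and \<gamma>: "circle_param (pts C) (cdist C) l \<gamma>"
    and C: "C = Circle (pts C) (cdist C) (range (\<lambda>a t. \<gamma> (t + a)))"
    using assms by (rule metric_circleE)
  have "range (\<lambda>a t. \<gamma> (- t + a)) = range (\<lambda>a t. \<gamma> (- (t + a)))"
  proof -
    have "range (\<lambda>a t. \<gamma> (- t + a)) = (\<lambda>a t. \<gamma> (- t + a)) ` range uminus"
      by simp
    then show ?thesis
      by (simp only: image_image minus_add_distrib)
  qed
  then have "params (flip C) = range (\<lambda>a t. \<gamma> (- (t + a)))"
    by (subst C) (simp add: flip_Circle)
  moreover have "is_circle (flip C)" "metric_on (pts C) (cdist C)"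
    using assms by (simp_all add: flip_def metric_circle_def)
  ultimately show ?thesis
    unfolding metric_circle_def pts_flip cdist_flip
    using circle_param_minus[OF M \<gamma>] by (intro conjI exI)
qed

text \<open>If the reversal of \<gamma> were one of its translates, the same germ would be described
  with both signs. This is the source of the factor 2 per circle in the count of
  sub-c-surfaces.\<close>

lemma flip_neq:
  assumes "metric_circle C"
  shows "flip C \<noteq> C"
proof
  obtain l \<gamma> where M: "Metric_space (pts C) (cdist C)" and \<gamma>: "circle_param (pts C) (cdist C) l \<gamma>"
    and C: "C = Circle (pts C) (cdist C) (range (\<lambda>a t. \<gamma> (t + a)))"
    using assms by (rule metric_circleE)
  assume "flip C = C"
  then have "range (\<lambda>a t. \<gamma> (- t + a)) = range (\<lambda>a t. \<gamma> (t + a))"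
    using C by (metis flip_Circle component.inject(1))
  then have "(\<lambda>t. \<gamma> (- t + 0)) \<in> range (\<lambda>a t. \<gamma> (t + a))"
    by (metis rangeI)
  then obtain a where "\<And>t. \<gamma> (- 1 * t + 0) = \<gamma> (1 * t + a)"
    by (auto simp: fun_eq_iff)
  then show False
    using same_germ_iff[OF M \<gamma>, of "- 1" 1 0 a 0] by simp
qed

lemma sub_component_refl_circle: "is_circle C \<Longrightarrow> pts C = pts D \<Longrightarrow> cdist C = cdist D \<Longrightarrow> sub_component C D"
  unfolding sub_component_def by (auto simp: component.distinct_disc intro: exI[of _ 1])

text \<open>The parametrization of \<open>C\<close> is a closed geodesic in \<open>D\<close>, so
  rigidity identifies the supports and the lengths; the sign \<sigma> records whether the
  orientations agree.\<close>

lemma sub_component_circle: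
  assumes C: "metric_circle C" and D: "metric_circle D" and sub: "sub_component C D"
  shows "C = D \<or> C = flip D"
proof -
  obtain l \<gamma> where M: "Metric_space (pts C) (cdist C)" and \<gamma>: "circle_param (pts C) (cdist C) l \<gamma>"
    and C_eq: "C = Circle (pts C) (cdist C) (range (\<lambda>a t. \<gamma> (t + a)))"
    using C by (rule metric_circleE)
  obtain l' \<delta> where M': "Metric_space (pts D) (cdist D)" and \<delta>: "circle_param (pts D) (cdist D) l' \<delta>"
    and D_eq: "D = Circle (pts D) (cdist D) (range (\<lambda>a t. \<delta> (t + a)))"
    using D by (rule metric_circleE)
  have "l > 0"
    using \<gamma> by (simp add: circle_param_def)
  have "\<exists>e>0. \<forall>s s'. \<bar>s - t\<bar> < e \<longrightarrow> \<bar>s' - t\<bar> < e \<longrightarrow> cdist D (\<gamma> s) (\<gamma> s') = \<bar>s - s'\<bar>" for t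
  proof -
    obtain e where e: "e > 0" "\<And>x y. x \<in> pts C \<Longrightarrow> y \<in> pts C \<Longrightarrow>
        cdist C (\<gamma> t) x < e \<Longrightarrow> cdist C (\<gamma> t) y < e \<Longrightarrow> cdist D x y = cdist C x y"
      using sub circle_param_in[OF M \<gamma>, of t] unfolding sub_component_def by blast
    \<comment> \<open>Within \<open>l / 4\<close> of \<open>t\<close>, distances in \<open>C\<close>
      are distances of parameters.\<close>
    define e' where "e' = min e (l / 4)"
    have e': "e' > 0" "e' \<le> e" "e' \<le> l / 4"
      using e \<open>l > 0\<close> by (auto simp: e'_def)
    have "cdist D (\<gamma> s) (\<gamma> s') = \<bar>s - s'\<bar>" if "\<bar>s - t\<bar> < e'" "\<bar>s' - t\<bar> < e'" for s s'
    proof -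
      have "cdist D (\<gamma> s) (\<gamma> s') = cdist C (\<gamma> s) (\<gamma> s')"
        using that e' circle_param_dist_le[OF M \<gamma>, of t s] circle_param_dist_le[OF M \<gamma>, of t s']
        by (intro e(2) circle_param_in[OF M \<gamma>]) linarith+
      also have "\<dots> = \<bar>s - s'\<bar>"
        using that e' by (intro circle_param_dist_small[OF M \<gamma>]) linarith
      finally show ?thesis .
    qed
    then show ?thesis
      using e' by blast
  qed
  then have "closed_geodesic (cdist D) l \<gamma>"
    using circle_param_geodesic[OF M \<gamma>] unfolding closed_geodesic_def by simp
  moreover have "range \<gamma> \<subseteq> pts D"
    using \<gamma> sub by (simp add: circle_param_def sub_component_def)
  ultimately obtain \<sigma> a where \<sigma>: "\<sigma> \<in> {1, - 1}" and eq: "\<And>t. \<gamma> t = \<delta> (\<sigma> * t + a)"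
    and pts: "range \<gamma> = pts D" and l: "l = l'"
    by (rule circle_param_rigid[OF M' \<delta>]) blast
  have pts: "pts C = pts D"
    using pts \<gamma> by (simp add: circle_param_def)
  have "cdist C x y = cdist D x y" for x y
  proof (cases "x \<in> pts C \<and> y \<in> pts C")
    case True
    then obtain s t where st: "x = \<gamma> s" "y = \<gamma> t"
      using \<gamma> unfolding circle_param_def by blast
    have "cdist D (\<delta> (\<sigma> * s + a)) (\<delta> (\<sigma> * t + a)) =
        infdist (s - t) (range (\<lambda>k::int. of_int k * l'))"
    proof (cases "\<sigma> = 1")
      case True
      then show ?thesis
        by (simp add: circle_param_dist[OF M' \<delta>])
    next
      case False
      then have "\<sigma> = - 1"
        using \<sigma> by simp
      then show ?thesis
        using circle_param_dist[OF M' circle_param_minus[OF M' \<delta>], of "s - a" "t - a"] by simp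
    qed
    then have "cdist D x y = cdist C x y"
      by (simp only: st circle_param_dist[OF M \<gamma>] eq[symmetric] l)
    then show ?thesis ..
  next
    \<comment> \<open>Outside the support both distances are fixed to be 0 by
      \<open>metric_on\<close>, so the two functions agree everywhere.\<close>
    case False
    then have "cdist C x y = 0"
      using C unfolding metric_circle_def metric_on_def by blast
    moreover have "cdist D x y = 0"
      using D False unfolding metric_circle_def metric_on_def pts by blast
    ultimately show ?thesis
      by simp
  qed
  then have dist: "cdist C = cdist D"
    by blast
  \<comment> \<open>The class of all translates absorbs the constant \<open>a\<close>: as
    \<open>b\<close> runs through the line, so does \<open>\<sigma> * b + a\<close>.\<close>
  have params: "range (\<lambda>b t. \<gamma> (t + b)) = range (\<lambda>b t. \<delta> (\<sigma> * t + b))"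
  proof -
    have "range (\<lambda>b t. \<gamma> (t + b)) = range (\<lambda>b t. \<delta> (\<sigma> * t + (\<sigma> * b + a)))"
      by (simp only: eq distrib_left add.assoc)
    also have "\<dots> = (\<lambda>b t. \<delta> (\<sigma> * t + b)) ` range (\<lambda>b. \<sigma> * b + a)"
      by (simp only: image_image)
    also have "range (\<lambda>b. \<sigma> * b + a) = UNIV"
      using \<sigma> by (intro surjI[of _ "\<lambda>c. \<sigma> * (c - a)"]) auto
    finally show ?thesis .
  qed
  have C_eq': "C = Circle (pts D) (cdist D) (range (\<lambda>b t. \<delta> (\<sigma> * t + b)))"
    by (rule trans[OF C_eq]) (simp only: pts dist params)
  show ?thesis
  proof (cases "\<sigma> = 1")
    case True
    then have "C = Circle (pts D) (cdist D) (range (\<lambda>b t. \<delta> (t + b)))"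
      using C_eq' by (simp only: mult_1)
    then show ?thesis
      using D_eq[symmetric] by (intro disjI1) (rule trans)
  next
    case False
    then have "\<sigma> = - 1"
      using \<sigma> by simp
    then have "C = Circle (pts D) (cdist D) (range (\<lambda>b t. \<delta> (- t + b)))"
      using C_eq' by (simp only: mult_minus1)
    also have "\<dots> = flip (Circle (pts D) (cdist D) (range (\<lambda>b t. \<delta> (t + b))))"
      by (rule flip_Circle[symmetric])
    also have "\<dots> = flip D"
      by (rule arg_cong[where f = flip, OF D_eq[symmetric]])
    finally show ?thesis ..
  qed
qed

section \<open>Length as an isometry invariant of circles\<close>

lemma geodesic_length_pos:
  assumes "metric_circle C"
  shows "geodesic_length (cdist C) (pts C) > 0"
  using assms by (rule metric_circleE) (metis geodesic_length_circle circle_param_def)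

lemma geodesic_length_isometry:
  assumes C: "metric_circle C" and D: "metric_circle D" and f: "comp_isometry f C D"
  shows "geodesic_length (cdist D) (pts D) = geodesic_length (cdist C) (pts C)"
proof -
  obtain l \<gamma> where M: "Metric_space (pts C) (cdist C)" and \<gamma>: "circle_param (pts C) (cdist C) l \<gamma>"
    using C by (rule metric_circleE)
  have "range (f \<circ> \<gamma>) = pts D"
    using f \<gamma> by (simp only: comp_isometry_def circle_param_def bij_betw_def image_comp[symmetric])
  moreover have "cdist D ((f \<circ> \<gamma>) s) ((f \<circ> \<gamma>) t) = cdist C (\<gamma> s) (\<gamma> t)" for s t
    using f circle_param_in[OF M \<gamma>] by (simp add: comp_isometry_def)
  ultimately have "circle_param (pts D) (cdist D) l (f \<circ> \<gamma>)"
    using \<gamma> unfolding circle_param_def by simp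
  moreover have "Metric_space (pts D) (cdist D)"
    using D by (simp add: metric_circle_def metric_on_def)
  ultimately show ?thesis
    using geodesic_length_circle M \<gamma> by metis
qed

subsection \<open>Topology of circles\<close>

text \<open>The standard covering \<open>p\<close> of the unit circle and \<gamma> identify the same
  points of the line. Hence \<gamma> descends to a continuous bijection from the compact unit circle
  onto a Hausdorff space.\<close>

lemma circle_homeomorphic:
  assumes "metric_circle C"
  obtains f where "homeomorphic_map unit_circle (comp_top C) f"
proof -
  obtain l \<gamma> where M: "Metric_space (pts C) (cdist C)" and \<gamma>: "circle_param (pts C) (cdist C) l \<gamma>"
    using assms by (rule metric_circleE)
  interpret Metric_space "pts C" "cdist C" by (fact M)
  have l: "l > 0"
    using \<gamma> by (simp add: circle_param_def)
  define p where "p = (\<lambda>t. cis (2 * pi * t / l))"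
  have p_eq_iff: "p s = p t \<longleftrightarrow> \<gamma> s = \<gamma> t" for s t
  proof -
    have "p s = p t \<longleftrightarrow> cis (2 * pi * (s - t) / l) = 1"
      by (simp add: p_def diff_divide_distrib right_diff_distrib flip: cis_divide)
    also have "\<dots> \<longleftrightarrow> (\<exists>k::int. 2 * pi * (s - t) / l = of_int (2 * k) * pi)"
    proof
      assume "cis (2 * pi * (s - t) / l) = 1"
      then have "cos (2 * pi * (s - t) / l) = 1"
        by (simp add: complex_eq_iff)
      then show "\<exists>k::int. 2 * pi * (s - t) / l = of_int (2 * k) * pi"
        by (simp add: cos_one_2pi_int mult_ac)
    next
      assume "\<exists>k::int. 2 * pi * (s - t) / l = of_int (2 * k) * pi"
      then obtain k :: int where "2 * pi * (s - t) / l = 2 * pi * of_int k"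
        by (auto simp: mult_ac)
      then show "cis (2 * pi * (s - t) / l) = 1"
        by (simp only: cis_multiple_2pi Ints_of_int)
    qed
    also have "\<dots> \<longleftrightarrow> (\<exists>k::int. s - t = of_int k * l)"
    proof (intro arg_cong[where f = Ex] ext)
      fix k :: int
      have "2 * pi * (s - t) / l - of_int (2 * k) * pi = (s - t - of_int k * l) * (2 * pi / l)"
        using l by (simp add: field_simps)
      moreover have "2 * pi / l \<noteq> 0"
        using l by simp
      ultimately show "(2 * pi * (s - t) / l = of_int (2 * k) * pi) = (s - t = of_int k * l)"
        by (metis eq_iff_diff_eq_0 mult_eq_0_iff)
    qed
    finally show ?thesis
      by (simp add: circle_param_eq_iff[OF M \<gamma>])
  qed
  have surj: "\<exists>t\<in>{0..l}. p t = z" if z: "z \<in> sphere 0 1" for z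
  proof -
    have "norm z = 1"
      using z by simp
    then have eq: "z = cis (Arg2pi z)"
      using Arg2pi_eq[of z] by (metis cis_conv_exp mult_1 of_real_1)
    have "p (l * Arg2pi z / (2 * pi)) = cis (Arg2pi z)"
    proof -
      have "2 * pi * (l * Arg2pi z / (2 * pi)) / l = Arg2pi z"
        using l by (simp add: field_simps)
      then show ?thesis
        by (simp only: p_def)
    qed
    then have "p (l * Arg2pi z / (2 * pi)) = z"
      using eq[symmetric] by (rule trans)
    moreover have "l * Arg2pi z / (2 * pi) \<in> {0..l}"
      using Arg2pi_ge_0[of z] Arg2pi_lt_2pi[of z] l by (simp add: field_simps)
    ultimately show ?thesis by blast
  qed
  have p_in: "p t \<in> sphere 0 1" for t
    by (simp add: p_def)
  have p_image: "p ` {0..l} = sphere 0 1" and p_range: "range p = sphere 0 1"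
    using surj p_in by blast+
  \<comment> \<open>The choice of \<open>t\<close> does not matter, since \<open>p\<close> and
    \<gamma> have the same fibres.\<close>
  define f where "f = (\<lambda>z. \<gamma> (SOME t. p t = z))"
  have f: "f (p t) = \<gamma> t" for t
  proof -
    have "p (SOME s. p s = p t) = p t"
      by (rule someI) (rule refl)
    then show ?thesis
      by (simp only: f_def p_eq_iff)
  qed
  have "continuous_map (top_of_set {0..l}) unit_circle p"
    unfolding p_def using l by (auto intro!: continuous_intros)
  moreover have "p ` topspace (top_of_set {0..l}) = topspace unit_circle"
    using p_image by simp
  \<comment> \<open>A continuous surjection from a compact space onto a Hausdorff space is a
    quotient map. Restricting to one period provides the compactness, and continuity of
    \<open>f\<close> can then be tested on \<open>f \<circ> p\<close>.\<close>
  ultimately have quot: "quotient_map (top_of_set {0..l}) unit_circle p"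
    by (intro continuous_imp_quotient_map)
      (auto simp: compact_space_subtopology Hausdorff_space_subtopology compactin_euclidean_iff)
  have "continuous_map euclideanreal mtopology \<gamma>"
    unfolding continuous_map_to_metric
  proof (intro ballI allI impI)
    fix t \<epsilon> :: real assume "\<epsilon> > 0"
    have "\<gamma> s \<in> mball (\<gamma> t) \<epsilon>" if "s \<in> ball t \<epsilon>" for s
      using that circle_param_in[OF M \<gamma>] circle_param_dist_le[OF M \<gamma>, of t s]
      by (simp add: in_mball dist_real_def)
    then show "\<exists>U. openin euclideanreal U \<and> t \<in> U \<and> (\<forall>s\<in>U. \<gamma> s \<in> mball (\<gamma> t) \<epsilon>)"
      using \<open>\<epsilon> > 0\<close> by (intro exI[of _ "ball t \<epsilon>"]) auto
  qed
  then have "continuous_map (top_of_set {0..l}) mtopology (f \<circ> p)"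
    by (simp add: o_def f continuous_map_from_subtopology)
  then have "continuous_map unit_circle mtopology f"
    by (rule continuous_compose_quotient_map[OF quot])
  moreover have "f ` sphere 0 1 = pts C"
    using \<gamma> by (simp add: image_image f circle_param_def flip: p_range)
  moreover have "inj_on f (sphere 0 1)"
    unfolding p_range[symmetric] by (auto simp: inj_on_def f p_eq_iff)
  ultimately have "homeomorphic_map unit_circle mtopology f"
    by (intro continuous_imp_homeomorphic_map Hausdorff_space_mtopology)
      (auto simp: compact_space_subtopology compactin_euclidean_iff)
  then show thesis
    using that by (simp add: comp_top_def)
qed

lemma topspace_comp_top: "metric_circle C \<Longrightarrow> topspace (comp_top C) = pts C"
  by (simp add: comp_top_def metric_circle_def metric_on_def Metric_space.topspace_mtopology)

lemma not_contractible_unit_circle: "\<not> contractible_space unit_circle"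
  by (simp add: contractible_sphere)

lemma not_contractible_circle: "metric_circle C \<Longrightarrow> \<not> contractible_space (comp_top C)"
  by (metis circle_homeomorphic homeomorphic_map_imp_homeomorphic_space
      homeomorphic_space_contractibility not_contractible_unit_circle)

lemma connected_circle: "metric_circle C \<Longrightarrow> connected_space (comp_top C)"
proof -
  assume "metric_circle C"
  then obtain f where "homeomorphic_map unit_circle (comp_top C) f"
    by (rule circle_homeomorphic)
  moreover have "connected_space unit_circle"
    by (simp add: connected_space_subtopology connectedin_iff_connected connected_sphere)
  ultimately show ?thesis
    using homeomorphic_connected_space homeomorphic_map_imp_homeomorphic_space by blast
qed

text \<open>As \<open>C\<close> is clopen, the inverse of \<open>f\<close> on \<open>C\<close>
  extends by a constant to a continuous map \<open>r\<close> into the unit circle with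
  \<open>r \<circ> f\<close> the identity. If \<open>g\<close> missed \<open>C\<close> or were
  constant, \<open>r \<circ> g\<close> would be constant and the unit circle contractible.\<close>

lemma clopen_circle_homotopy:
  assumes f: "parametrizes X f C" and C: "openin X C" "closedin X C"
    and hom: "freely_homotopic X f g"
  shows "g ` sphere 0 1 \<inter> C \<noteq> {}" and "\<not> (\<forall>z\<in>sphere 0 1. g z = a)"
proof -
  have "homeomorphic_map unit_circle (subtopology X C) f"
    using f by (auto simp: parametrizes_def embedding_map_def)
  then obtain r0 where r0: "homeomorphic_maps unit_circle (subtopology X C) f r0"
    by (auto simp: homeomorphic_map_maps)
  define r where "r = (\<lambda>x. if x \<in> C then r0 x else 1)"
  have C': "closedin X (topspace X - C)"
    using C by blast
  have r: "continuous_map X unit_circle r"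
    unfolding r_def
  proof (rule continuous_map_cases_alt)
    have 1: "{x \<in> topspace X. x \<in> C} = C" "{x \<in> topspace X. x \<notin> C} = topspace X - C"
      using openin_subset[OF C(1)] by auto
    show "continuous_map (subtopology X (X closure_of {x \<in> topspace X. x \<in> C})) unit_circle r0"
      using r0 C by (simp add: 1 closure_of_closedin homeomorphic_maps_def)
    show "continuous_map (subtopology X (X closure_of {x \<in> topspace X. x \<notin> C})) unit_circle (\<lambda>_. 1)"
      by simp
    \<comment> \<open>A clopen set has empty frontier, so the gluing condition is vacuous.\<close>
    show "r0 x = 1" if "x \<in> X frontier_of {x \<in> topspace X. x \<in> C}" for x
      using that C unfolding 1 by (simp add: frontier_of_def closure_of_closedin interior_of_openin)
  qed
  have rf: "(r \<circ> f) z = z" if "z \<in> sphere 0 1" for z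
  proof -
    have "f z \<in> C"
      using f that unfolding parametrizes_def by blast
    moreover have "r0 (f z) = z"
      using r0 that unfolding homeomorphic_maps_def by simp
    ultimately show ?thesis
      by (simp only: r_def o_def if_True)
  qed
  have nonconst: "\<not> (\<forall>z\<in>sphere 0 1. r (g z) = c)" for c
  proof
    assume c: "\<forall>z\<in>sphere 0 1. r (g z) = c"
    have "homotopic_with (\<lambda>_. True) unit_circle unit_circle (r \<circ> f) (r \<circ> g)"
      using hom r unfolding freely_homotopic_def
      by (rule homotopic_with_compose_continuous_map_left) simp
    then have "homotopic_with (\<lambda>_. True) unit_circle unit_circle id (\<lambda>_. c)"
      by (rule homotopic_with_eq) (simp_all add: rf[unfolded o_apply] c)
    then show False
      using not_contractible_unit_circle by (auto simp: contractible_space_def)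
  qed
  show "g ` sphere 0 1 \<inter> C \<noteq> {}"
  proof
    assume "g ` sphere 0 1 \<inter> C = {}"
    then have "g z \<notin> C" if "z \<in> sphere 0 1" for z
      using that by blast
    then have "r (g z) = 1" if "z \<in> sphere 0 1" for z
      using that by (simp only: r_def if_False)
    then show False
      using nonconst by blast
  qed
  show "\<not> (\<forall>z\<in>sphere 0 1. g z = a)"
  proof
    assume "\<forall>z\<in>sphere 0 1. g z = a"
    then have "\<forall>z\<in>sphere 0 1. r (g z) = r a"
      by simp
    then show False
      using nonconst by blast
  qed
qed

subsection \<open>c-surfaces whose components are circles\<close>

definition circle_surface :: "csurface \<Rightarrow> bool" where
  "circle_surface Z \<longleftrightarrow> c_surface Z \<and> (\<forall>C\<in>set Z. metric_circle C)"

lemma comp_sig_metric_circle: "metric_circle C \<Longrightarrow> comp_sig C = (0, 2)"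
  by (cases C) (auto simp: metric_circle_def)

lemma signature_circle_surface: "circle_surface Z \<Longrightarrow> signature Z = replicate (length Z) (0, 2)"
  by (auto simp: circle_surface_def signature_def comp_sig_metric_circle map_replicate_const[symmetric])

text \<open>Hyperbolic surfaces satisfy \<open>2 * g + n > 2\<close>, which excludes the signature
  \<open>(0, 2)\<close>.\<close>

lemma circle_surface_if_signature:
  assumes "c_surface Z" "signature Z = replicate q (0, 2)"
  shows "circle_surface Z" "length Z = q"
proof -
  show "length Z = q"
    using assms(2) by (metis length_map length_replicate signature_def)
  have "comp_sig C = (0, 2)" if "C \<in> set Z" for C
  proof -
    have "comp_sig C \<in> set (signature Z)"
      using that by (simp add: signature_def)
    then show ?thesis
      using assms(2) by auto
  qed
  then show "circle_surface Z"
    using assms(1) by (fastforce simp: circle_surface_def c_surface_def hyp_surface_def)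
qed

text \<open>All signatures are equal, so the ordering condition holds in any order of the circles.
  This is why every ordering appears among the sub-c-surfaces.\<close>

lemma circle_surface_iff:
  "circle_surface Z \<longleftrightarrow> Z \<noteq> [] \<and> (\<forall>C\<in>set Z. metric_circle C) \<and>
     (\<forall>i<length Z. \<forall>j<length Z. i \<noteq> j \<longrightarrow> pts (Z ! i) \<inter> pts (Z ! j) = {})"
proof -
  have "signature Z \<in> signatures (length Z)" if "\<forall>C\<in>set Z. metric_circle C"
  proof -
    have "signature Z = replicate (length Z) (0, 2)"
      using that by (auto simp: signature_def comp_sig_metric_circle map_replicate_const[symmetric])
    then show ?thesis
      by (auto simp: signatures_def sig_le_def)
  qed
  then show ?thesis
    by (auto simp: circle_surface_def c_surface_def)
qed

lemma circle_surface_distinct: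
  assumes Z: "circle_surface Z"
  shows "distinct (map pts Z)"
proof (unfold distinct_conv_nth, intro allI impI)
  fix i j assume ij: "i < length (map pts Z)" "j < length (map pts Z)" "i \<noteq> j"
  have "pts (Z ! i) \<noteq> {}"
    using ij Z metric_circle_nonempty by (simp add: circle_surface_iff)
  then show "map pts Z ! i \<noteq> map pts Z ! j"
    using Z ij by (fastforce simp: circle_surface_iff)
qed

section \<open>Clopen components of a union of circles\<close>

context
  fixes Z
  assumes Z: "circle_surface Z"
begin

lemma circle_surface_c_surface: "c_surface Z"
  and circle_surface_nonempty: "Z \<noteq> []"
  and circle_surface_metric_circle: "C \<in> set Z \<Longrightarrow> metric_circle C"
  and circle_surface_is_circle: "C \<in> set Z \<Longrightarrow> is_circle C"
  using Z by (auto simp: circle_surface_def c_surface_def metric_circle_def)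

lemma circle_surface_pts_disjoint:
  assumes "i < length Z" "j < length Z" "i \<noteq> j"
  shows "pts (Z ! i) \<inter> pts (Z ! j) = {}"
  using Z assms by (simp add: circle_surface_iff)

lemma circle_surface_inj:
  assumes "C \<in> set Z" "D \<in> set Z" "pts C \<inter> pts D \<noteq> {}"
  shows "C = D"
  using assms circle_surface_pts_disjoint by (metis in_set_conv_nth)

lemma openin_circle:
  assumes C: "C \<in> set Z"
  shows "openin (comp_top C) (pts C)"
  using openin_topspace unfolding topspace_comp_top[OF circle_surface_metric_circle[OF C], symmetric] .

lemma topspace_circle_surface: "topspace (cs_top Z) = points Z"
proof (rule antisym)
  show "topspace (cs_top Z) \<subseteq> points Z"
    using openin_topspace[of "cs_top Z"] unfolding openin_cs_top by blast
  have "points Z \<inter> pts C = pts C" if "C \<in> set Z" for C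
    using that by (auto simp: points_def)
  then have "openin (cs_top Z) (points Z)"
    unfolding openin_cs_top using openin_circle by simp
  then show "points Z \<subseteq> topspace (cs_top Z)"
    by (rule openin_subset)
qed

lemma openin_subset_circle:
  assumes C: "C \<in> set Z" and U: "openin (comp_top C) U"
  shows "openin (cs_top Z) U"
  unfolding openin_cs_top
proof (intro conjI ballI)
  have sub: "U \<subseteq> pts C"
    using openin_subset[OF U] topspace_comp_top[OF circle_surface_metric_circle[OF C]] by simp
  then show "U \<subseteq> points Z"
    using C by (auto simp: points_def)
  show "openin (comp_top D) (U \<inter> pts D)" if D: "D \<in> set Z" for D
  proof (cases "C = D")
    case True
    then show ?thesis
      using U sub by (simp add: Int_absorb2)
  next
    case False
    then have "U \<inter> pts D = {}"
      using circle_surface_inj[OF C D] sub by auto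
    then show ?thesis
      by simp
  qed
qed

lemma openin_cs_circle: "C \<in> set Z \<Longrightarrow> openin (cs_top Z) (pts C)"
  by (rule openin_subset_circle[OF _ openin_circle])

lemma closedin_cs_circle:
  assumes C: "C \<in> set Z"
  shows "closedin (cs_top Z) (pts C)"
  unfolding closedin_def
proof
  show "pts C \<subseteq> topspace (cs_top Z)"
    using openin_cs_circle[OF C] by (rule openin_subset)
  have "topspace (cs_top Z) - pts C = (\<Union>D\<in>set Z - {C}. pts D)"
    unfolding topspace_circle_surface points_def using circle_surface_inj[OF C] C by blast
  then show "openin (cs_top Z) (topspace (cs_top Z) - pts C)"
    using openin_cs_circle by auto
qed

lemma subtopology_cs_circle:
  assumes C: "C \<in> set Z"
  shows "subtopology (cs_top Z) (pts C) = comp_top C"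
  unfolding topology_eq
proof
  fix U
  show "openin (subtopology (cs_top Z) (pts C)) U = openin (comp_top C) U"
  proof
    assume "openin (subtopology (cs_top Z) (pts C)) U"
    then show "openin (comp_top C) U"
      using C by (auto simp: openin_subtopology openin_cs_top)
  next
    assume U: "openin (comp_top C) U"
    then have "U \<subseteq> pts C"
      using openin_subset topspace_comp_top[OF circle_surface_metric_circle[OF C]] by blast
    then show "openin (subtopology (cs_top Z) (pts C)) U"
      using openin_subset_circle[OF C U] by (auto simp: openin_subtopology)
  qed
qed

text \<open>Each circle is clopen in the union, so no homotopy can contract it or move it onto a
  curve disjoint from it.\<close>

lemma multicurve_circles:
  assumes sub: "\<C> \<subseteq> pts ` set Z"
  shows "multicurve (cs_top Z) \<C>"
proof -
  have disj: "C \<inter> D = {}" if "C \<in> \<C>" "D \<in> \<C>" "C \<noteq> D" for C D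
    using that sub circle_surface_inj by blast
  have clopen: "openin (cs_top Z) C" "closedin (cs_top Z) C" if "C \<in> \<C>" for C
    using that sub openin_cs_circle closedin_cs_circle by auto
  have "\<exists>f. parametrizes (cs_top Z) f C \<and> \<not> null_homotopic (cs_top Z) f" if C: "C \<in> \<C>" for C
  proof -
    obtain D where D: "D \<in> set Z" "C = pts D"
      using C sub by blast
    obtain f where f: "homeomorphic_map unit_circle (comp_top D) f"
      using circle_homeomorphic circle_surface_metric_circle D by blast
    have "f ` sphere 0 1 = C"
      using homeomorphic_imp_surjective_map[OF f] topspace_comp_top circle_surface_metric_circle D
      by simp
    then have "parametrizes (cs_top Z) f C"
      using f D by (simp add: parametrizes_def embedding_map_def subtopology_cs_circle)
    then show ?thesis
      using clopen_circle_homotopy(2)[OF _ clopen[OF C]] unfolding null_homotopic_def by blast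
  qed
  moreover have "\<not> freely_homotopic (cs_top Z) f g"
    if "C \<in> \<C>" "C' \<in> \<C>" "C \<noteq> C'" "parametrizes (cs_top Z) f C" "parametrizes (cs_top Z) g C'" for C C' f g
    using clopen_circle_homotopy(1)[OF that(4) clopen[OF that(1)], of g] disj[OF that(1-3)] that(5)
    unfolding parametrizes_def by blast
  ultimately show ?thesis
    unfolding multicurve_def pairwise_def disjnt_def using disj by blast
qed

section \<open>Sub-c-surfaces of a union of circles\<close>

lemma circle_surface_sub_csurfaces:
  assumes "\<tau> \<in> sub_csurfaces Z"
  shows "circle_surface \<tau>"
proof -
  have \<tau>: "c_surface \<tau>" and sub: "\<And>C. C \<in> set \<tau> \<Longrightarrow> \<exists>D\<in>set Z. sub_component C D"
    using assms by (auto simp: sub_csurfaces_def)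
  have "metric_circle C" if C: "C \<in> set \<tau>" for C
  proof -
    obtain D where D: "D \<in> set Z" "sub_component C D"
      using sub[OF C] by blast
    \<comment> \<open>A surface component can only lie in a surface component.\<close>
    have "\<not> is_surface C"
      using D(2) circle_surface_is_circle[OF D(1)] component.distinct_disc
      unfolding sub_component_def by blast
    then show ?thesis
      using \<tau> C unfolding c_surface_def hyp_surface_def by blast
  qed
  then show ?thesis
    using \<tau> by (simp add: circle_surface_def)
qed

text \<open>What remains of the geometry is the choice of some circles, an order and an orientation
  of each. Distinct supports already give disjointness, since each support is that of a component of
  \<open>Z\<close>.\<close>

lemma sub_csurfaces_circles:
  "sub_csurfaces Z = {\<tau>. \<tau> \<noteq> [] \<and> set \<tau> \<subseteq> set Z \<union> flip ` set Z \<and> distinct (map pts \<tau>)}"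
    (is "_ = ?S")
proof (intro antisym subsetI)
  fix \<tau> assume \<tau>: "\<tau> \<in> sub_csurfaces Z"
  then have sub: "\<And>C. C \<in> set \<tau> \<Longrightarrow> \<exists>D\<in>set Z. sub_component C D"
    by (auto simp: sub_csurfaces_def)
  have cs: "circle_surface \<tau>"
    using \<tau> by (rule circle_surface_sub_csurfaces)
  then have circ: "metric_circle C" if "C \<in> set \<tau>" for C
    using that by (simp add: circle_surface_def)
  have "set \<tau> \<subseteq> set Z \<union> flip ` set Z"
    using sub circ sub_component_circle circle_surface_metric_circle by blast
  then show "\<tau> \<in> ?S"
    using circle_surface_distinct[OF cs] cs by (simp add: circle_surface_iff)
next
  fix \<tau> assume "\<tau> \<in> ?S"
  then have \<tau>: "\<tau> \<noteq> []" "set \<tau> \<subseteq> set Z \<union> flip ` set Z" "distinct (map pts \<tau>)"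
    by auto
  have "\<exists>D\<in>set Z. pts C = pts D \<and> sub_component C D \<and> metric_circle C" if C: "C \<in> set \<tau>" for C
  proof -
    obtain D where D: "D \<in> set Z" "C = D \<or> C = flip D"
      using \<tau> C by blast
    then have "metric_circle C" "pts C = pts D" "cdist C = cdist D"
      using circle_surface_metric_circle metric_circle_flip by auto
    then show ?thesis
      using D sub_component_refl_circle metric_circle_is_circle by blast
  qed
  then obtain D where D: "\<And>C. C \<in> set \<tau> \<Longrightarrow>
      D C \<in> set Z \<and> pts C = pts (D C) \<and> sub_component C (D C) \<and> metric_circle C"
    by metis
  have "pts (\<tau> ! i) \<inter> pts (\<tau> ! j) = {}" if "i < length \<tau>" "j < length \<tau>" "i \<noteq> j" for i j
  proof (rule ccontr)
    assume "pts (\<tau> ! i) \<inter> pts (\<tau> ! j) \<noteq> {}"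
    then have "D (\<tau> ! i) = D (\<tau> ! j)"
      using that D by (intro circle_surface_inj) auto
    then have "pts (\<tau> ! i) = pts (\<tau> ! j)"
      using that D by (metis nth_mem)
    then show False
      using that \<tau>(3) by (simp add: distinct_conv_nth)
  qed
  then have cs: "circle_surface \<tau>"
    using \<tau>(1) D by (simp add: circle_surface_iff)
  have "boundary_curves \<tau> \<subseteq> pts ` set Z"
    using D metric_circle_is_circle by (fastforce simp: boundary_curves_def split: if_splits)
  then show "\<tau> \<in> sub_csurfaces Z"
    using cs D multicurve_circles unfolding sub_csurfaces_def circle_surface_def by blast
qed

text \<open>A circle that avoids \<open>E\<close> remains clopen and connected in the complement of
  \<open>E\<close>.\<close>

lemma connected_component_circle:
  assumes C: "C \<in> set Z" and E: "pts C \<inter> E = {}"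
  shows "pts C \<in> connected_components_of (subtopology (cs_top Z) (points Z - E))"
proof -
  let ?X = "subtopology (cs_top Z) (points Z - E)"
  have sub: "pts C \<subseteq> points Z - E"
    using C E by (auto simp: points_def)
  have op: "openin ?X (pts C)"
    unfolding openin_subtopology using openin_cs_circle[OF C] sub by (intro exI[of _ "pts C"]) auto
  have cl: "closedin ?X (pts C)"
    unfolding closedin_subtopology using closedin_cs_circle[OF C] sub by (intro exI[of _ "pts C"]) auto
  have "connectedin (cs_top Z) (pts C)"
    using connected_circle[OF circle_surface_metric_circle[OF C]] openin_subset[OF openin_cs_circle[OF C]]
    by (simp add: connectedin_def subtopology_cs_circle[OF C])
  then have conn: "connectedin ?X (pts C)"
    using sub by (simp add: connectedin_subtopology)
  obtain x where x: "x \<in> pts C"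
    using metric_circle_nonempty[OF circle_surface_metric_circle[OF C]] by blast
  have "x \<in> \<Union> (connected_components_of ?X)"
    using openin_subset[OF op] x by (simp only: Union_connected_components_of subsetD)
  then obtain K where K: "K \<in> connected_components_of ?X" "x \<in> K"
    by (rule UnionE)
  have "\<not> disjnt K (pts C)"
    using K(2) x by (auto simp: disjnt_def)
  then have "pts C \<subseteq> K" "K \<subseteq> pts C"
    using connected_components_of_maximal[OF K(1) conn]
      connectedin_clopen_cases[OF connectedin_connected_components_of[OF K(1)] cl op] by simp_all
  then show ?thesis
    using K(1) by simp
qed

end

text \<open>By counting, \<tau> uses each circle of \<open>Z\<close> exactly once. As
  \<open>diffeo_related\<close> ignores orientations, the identity serves as the isometry between
  matching circles.\<close>

lemma diffeo_related_circles:
  assumes Z: "circle_surface Z" and \<tau>: "\<tau> \<in> sub_csurfaces Z" and len: "length \<tau> = length Z"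
  shows "diffeo_related \<tau> Z"
proof -
  have "set \<tau> \<subseteq> set Z \<union> flip ` set Z" and dist: "distinct (map pts \<tau>)"
    using \<tau> by (auto simp: sub_csurfaces_circles[OF Z])
  then have "\<exists>j<length Z. pts (\<tau> ! i) = pts (Z ! j) \<and> cdist (\<tau> ! i) = cdist (Z ! j)"
    if "i < length \<tau>" for i
  proof -
    have "\<tau> ! i \<in> set Z \<union> flip ` set Z"
      using that \<open>set \<tau> \<subseteq> _\<close> nth_mem by blast
    then obtain D where "D \<in> set Z" "pts (\<tau> ! i) = pts D" "cdist (\<tau> ! i) = cdist D"
      by auto
    then show ?thesis
      by (metis in_set_conv_nth)
  qed
  then obtain \<pi> where \<pi>: "\<And>i. i < length \<tau> \<Longrightarrow>
      \<pi> i < length Z \<and> pts (\<tau> ! i) = pts (Z ! \<pi> i) \<and> cdist (\<tau> ! i) = cdist (Z ! \<pi> i)"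
    by metis
  have "inj_on \<pi> {..<length \<tau>}"
  proof (rule inj_onI)
    fix i j assume "i \<in> {..<length \<tau>}" "j \<in> {..<length \<tau>}" "\<pi> i = \<pi> j"
    then have ij: "i < length \<tau>" "j < length \<tau>" "pts (\<tau> ! i) = pts (\<tau> ! j)"
      using \<pi> by (metis lessThan_iff)+
    then show "i = j"
      using dist by (auto simp: distinct_conv_nth)
  qed
  moreover have "\<pi> ` {..<length \<tau>} \<subseteq> {..<length Z}"
    using \<pi> by auto
  ultimately have "bij_betw \<pi> {..<length \<tau>} {..<length Z}"
    unfolding bij_betw_def using len by (simp add: card_image card_subset_eq)
  moreover have "comp_isometry id (\<tau> ! i) (Z ! \<pi> i)" if "i < length \<tau>" for i
    using \<pi>[OF that] by (simp add: comp_isometry_def)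
  moreover have "signature \<tau> = signature Z"
    using signature_circle_surface[OF Z] signature_circle_surface[OF circle_surface_sub_csurfaces[OF Z \<tau>]] len
    by simp
  ultimately show ?thesis
    unfolding diffeo_related_def by blast
qed

subsection \<open>Derived tangles\<close>

lemma cs_class_self:
  assumes "c_surface Z"
  shows "Z \<in> cs_class Z"
proof -
  have "comp_iso id C C" for C
    by (cases C) (simp_all add: comp_iso_def comp_isometry_def)
  then show ?thesis
    using assms by (auto simp: cs_class_def cs_iso_def)
qed

lemma derived_tangle_circles_iff:
  assumes Z: "circle_surface Z"
  shows "derived_tangle \<kappa> R Z \<longleftrightarrow> (\<forall>C\<in>set Z. geodesic_length (cdist C) (pts C) \<le> \<kappa>)"
proof
  assume "derived_tangle \<kappa> R Z"
  then obtain F where F: "F \<subseteq> {\<tau> \<in> sub_csurfaces Z. is_tangle \<kappa> R \<tau>}"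
    and fill: "weakly_fills (\<Union>\<tau>\<in>F. points \<tau>) Z"
    by (auto simp: derived_tangle_def)
  show "\<forall>C\<in>set Z. geodesic_length (cdist C) (pts C) \<le> \<kappa>"
  proof
    fix C assume C: "C \<in> set Z"
    have "pts C \<inter> (\<Union>\<tau>\<in>F. points \<tau>) \<noteq> {}"
    proof
      assume "pts C \<inter> (\<Union>\<tau>\<in>F. points \<tau>) = {}"
      from connected_component_circle[OF Z C this]
      have "contractible_space (subtopology (cs_top Z) (pts C)) \<or> pts C \<subseteq> points (filter is_surface Z)"
        using fill unfolding weakly_fills_def by blast
      moreover have "\<not> contractible_space (subtopology (cs_top Z) (pts C))"
        using not_contractible_circle[OF circle_surface_metric_circle[OF Z C]]
        by (simp add: subtopology_cs_circle[OF Z C])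
      \<comment> \<open>The annular alternative of weak filling is confined to the 2d part, which is
        empty here.\<close>
      moreover have "points (filter is_surface Z) = {}"
        using circle_surface_is_circle[OF Z] component.distinct_disc by (auto simp: points_def)
      ultimately show False
        using metric_circle_nonempty[OF circle_surface_metric_circle[OF Z C]] by simp
    qed
    then obtain \<tau> where \<tau>: "\<tau> \<in> F" "pts C \<inter> points \<tau> \<noteq> {}"
      by blast
    then have sub: "\<tau> \<in> sub_csurfaces Z" and "is_tangle \<kappa> R \<tau>"
      using F by auto
    then obtain D where D: "\<tau> = [D]"
      "is_circle D \<and> geodesic_length (cdist D) (pts D) \<le> \<kappa> \<or> is_surface D"
      unfolding is_tangle_def by blast
    have "is_circle D"
      using circle_surface_is_circle[OF circle_surface_sub_csurfaces[OF Z sub]] D(1) by simp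
    then have le: "geodesic_length (cdist D) (pts D) \<le> \<kappa>"
      using D(2) component.distinct_disc by blast
    have "D \<in> set Z \<union> flip ` set Z"
      using sub D(1) by (simp add: sub_csurfaces_circles[OF Z])
    then obtain C' where C': "C' \<in> set Z" "pts D = pts C'" "cdist D = cdist C'"
      by auto
    have "C = C'"
      using \<tau>(2) C' D(1) by (intro circle_surface_inj[OF Z C]) (auto simp: points_def)
    then show "geodesic_length (cdist C) (pts C) \<le> \<kappa>"
      using le C' by simp
  qed
next
  assume le: "\<forall>C\<in>set Z. geodesic_length (cdist C) (pts C) \<le> \<kappa>"
  define F where "F = (\<lambda>C. [C]) ` set Z"
  have sub: "[C] \<in> sub_csurfaces Z" if "C \<in> set Z" for C
    using that by (simp add: sub_csurfaces_circles[OF Z])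
  have "is_tangle \<kappa> R [C]" if C: "C \<in> set Z" for C
    using le C circle_surface_is_circle[OF Z C] circle_surface_sub_csurfaces[OF Z sub[OF C]]
    by (simp add: is_tangle_def circle_surface_def)
  then have "F \<subseteq> {\<tau> \<in> sub_csurfaces Z. is_tangle \<kappa> R \<tau>}"
    using sub by (auto simp: F_def)
  moreover have "(\<Union>\<tau>\<in>F. points \<tau>) = points Z"
    by (simp add: F_def points_def)
  moreover have "weakly_fills (points Z) Z"
    using connected_components_of_eq_empty[of "subtopology (cs_top Z) {}"]
    by (simp add: weakly_fills_def)
  moreover have "countable F"
    by (simp add: F_def countable_finite)
  ultimately show "derived_tangle \<kappa> R Z"
    using circle_surface_c_surface[OF Z] unfolding derived_tangle_def
    by (intro conjI exI[of _ F]) simp_all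
qed

text \<open>Membership only provides some representative \<open>Z'\<close> of the class. It is
  isometric to \<open>Z\<close> component by component, and the lengths that decide the matter are
  isometry invariants.\<close>

lemma derived_tangles_circles_iff:
  assumes Z: "circle_surface Z"
  shows "cs_class Z \<in> derived_tangles \<kappa> R \<longleftrightarrow>
    (\<forall>C\<in>set Z. geodesic_length (cdist C) (pts C) \<le> \<kappa>)"
proof
  assume "cs_class Z \<in> derived_tangles \<kappa> R"
  then obtain Z' where Z': "derived_tangle \<kappa> R Z'" and eq: "cs_class Z = cs_class Z'"
    by (auto simp: derived_tangles_def)
  have cs: "c_surface Z'"
    using Z' by (simp add: derived_tangle_def)
  then have "Z' \<in> cs_class Z"
    unfolding eq by (rule cs_class_self)
  then have iso: "length Z = length Z'" "\<And>i. i < length Z \<Longrightarrow> \<exists>f. comp_iso f (Z ! i) (Z' ! i)"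
    by (auto simp: cs_class_def cs_iso_def)
  have "metric_circle D" if D: "D \<in> set Z'" for D
  proof -
    obtain i where i: "i < length Z'" "D = Z' ! i"
      using D by (auto simp: in_set_conv_nth)
    then have "is_circle (Z ! i)"
      using circle_surface_is_circle[OF Z] iso(1) by simp
    then have "is_circle D"
      using iso(2)[of i] iso(1) i component.distinct_disc unfolding comp_iso_def by auto
    then show ?thesis
      using cs D component.distinct_disc unfolding c_surface_def hyp_surface_def by blast
  qed
  then have circ: "circle_surface Z'"
    using cs by (simp add: circle_surface_def)
  show "\<forall>C\<in>set Z. geodesic_length (cdist C) (pts C) \<le> \<kappa>"
  proof
    fix C assume C: "C \<in> set Z"
    then obtain i where i: "i < length Z" "C = Z ! i"
      by (auto simp: in_set_conv_nth)
    then have D: "Z' ! i \<in> set Z'"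
      using iso(1) by simp
    obtain f where "comp_isometry f C (Z' ! i)"
      using iso(2)[OF i(1)] i(2) by (auto simp: comp_iso_def)
    then have "geodesic_length (cdist C) (pts C) = geodesic_length (cdist (Z' ! i)) (pts (Z' ! i))"
      using geodesic_length_isometry circle_surface_metric_circle Z C circ D by metis
    then show "geodesic_length (cdist C) (pts C) \<le> \<kappa>"
      using Z' D unfolding derived_tangle_circles_iff[OF circ] by simp
  qed
next
  assume "\<forall>C\<in>set Z. geodesic_length (cdist C) (pts C) \<le> \<kappa>"
  then show "cs_class Z \<in> derived_tangles \<kappa> R"
    using derived_tangle_circles_iff[OF Z] by (auto simp: derived_tangles_def)
qed

subsection \<open>Counting\<close>

lemma card_distinct_fibre_lists:
  assumes T: "finite T" and q: "card (f ` T) = q"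
    and m: "\<And>y. y \<in> f ` T \<Longrightarrow> card {x \<in> T. f x = y} = m"
    and k: "k \<le> q"
  shows "card {xs. length xs = k \<and> set xs \<subseteq> T \<and> distinct (map f xs)} * fact (q - k) = m ^ k * fact q"
  using k
proof (induction k)
  case 0
  have "{xs. length xs = 0 \<and> set xs \<subseteq> T \<and> distinct (map f xs)} = {[]}"
    by auto
  then show ?case
    by simp
next
  case (Suc k)
  let ?S = "\<lambda>k. {xs. length xs = k \<and> set xs \<subseteq> T \<and> distinct (map f xs)}"
  let ?B = "\<lambda>xs. {x \<in> T. f x \<notin> f ` set xs}"
  have fin: "finite (?S k)"
    using finite_lists_length_eq[OF T, of k] by (rule rev_finite_subset) auto
  have card_B: "card (?B xs) = m * (q - k)" if xs: "xs \<in> ?S k" for xs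
  proof -
    have "?B xs = (\<Union>y\<in>f ` T - f ` set xs. {x \<in> T. f x = y})"
      by (rule set_eqI, unfold UN_iff mem_Collect_eq) (metis DiffE DiffI imageI)
    also have "card \<dots> = (\<Sum>y\<in>f ` T - f ` set xs. card {x \<in> T. f x = y})"
      by (rule card_UN_disjoint) (use T in auto)
    also have "\<dots> = m * card (f ` T - f ` set xs)"
      using m by simp
    also have "card (f ` T - f ` set xs) = q - card (f ` set xs)"
      using xs by (subst card_Diff_subset) (auto simp: q)
    also have "card (f ` set xs) = k"
      using xs distinct_card[of "map f xs"] by auto
    finally show ?thesis .
  qed
  have "?S (Suc k) = (\<lambda>(xs, x). x # xs) ` (SIGMA xs:?S k. ?B xs)"
  proof (intro antisym subsetI)
    fix ys assume "ys \<in> ?S (Suc k)"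
    then show "ys \<in> (\<lambda>(xs, x). x # xs) ` (SIGMA xs:?S k. ?B xs)"
      by (cases ys) (auto intro!: image_eqI[of _ _ "(tl ys, hd ys)"])
  qed auto
  also have "card \<dots> = card (SIGMA xs:?S k. ?B xs)"
    by (rule card_image) (auto simp: inj_on_def)
  also have "\<dots> = (\<Sum>xs\<in>?S k. card (?B xs))"
    using fin T by (intro card_SigmaI) auto
  also have "\<dots> = card (?S k) * (m * (q - k))"
    using card_B by simp
  finally have "card (?S (Suc k)) * fact (q - Suc k) = m * (card (?S k) * ((q - k) * fact (q - Suc k)))"
    by (simp only: mult_ac)
  also have "(q - k) * fact (q - Suc k) = fact (q - k)"
    using Suc.prems fact_reduce[of "q - k", where ?'a = nat] by simp
  also have "card (?S k) * fact (q - k) = m ^ k * fact q"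
    using Suc by simp
  finally show ?case
    by simp
qed

text \<open>The full alternating sum is \<open>(1 - 1) ^ q = 0\<close>; the term
  \<open>k = 0\<close> is left out because a sub-c-surface is nonempty.\<close>

lemma alternating_binomial_sum:
  assumes "q \<ge> 1"
  shows "(\<Sum>k=1..q. (- 1) ^ (k + 1) * real (q choose k)) = 1"
proof -
  have "0 = (\<Sum>k\<le>q. (- 1) ^ k * real (q choose k))"
    using choose_alternating_sum[of q, where ?'a = real] assms by simp
  also have "{..q} = insert 0 {1..q}"
    by auto
  also have "(\<Sum>k\<in>insert 0 {1..q}. (- 1) ^ k * real (q choose k)) =
      1 + (\<Sum>k=1..q. (- 1) ^ k * real (q choose k))"
    by simp
  finally show ?thesis
    by (simp add: sum_negf)
qed

text \<open>Here the fibres of \<open>pts\<close> are the pairs \<open>{C, flip C}\<close> of the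
  two orientations of a circle.\<close>

lemma card_sub_csurfaces:
  assumes Z: "circle_surface Z" and k: "1 \<le> k" "k \<le> length Z"
  shows "real (card {\<tau> \<in> sub_csurfaces Z. length \<tau> = k}) =
    2 ^ k * fact (length Z) / fact (length Z - k)"
proof -
  let ?T = "set Z \<union> flip ` set Z"
  have img: "pts ` ?T = pts ` set Z"
    by (auto simp: image_Un image_image)
  have "{\<tau> \<in> sub_csurfaces Z. length \<tau> = k} =
      {\<tau>. length \<tau> = k \<and> set \<tau> \<subseteq> ?T \<and> distinct (map pts \<tau>)}"
    using k by (auto simp: sub_csurfaces_circles[OF Z])
  moreover have "card {\<tau>. length \<tau> = k \<and> set \<tau> \<subseteq> ?T \<and> distinct (map pts \<tau>)} * fact (length Z - k) =
      2 ^ k * fact (length Z)"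
  proof (rule card_distinct_fibre_lists)
    show "card (pts ` ?T) = length Z"
      using distinct_card[OF circle_surface_distinct[OF Z]] by (simp add: img)
    fix y assume "y \<in> pts ` ?T"
    then obtain C where C: "C \<in> set Z" "y = pts C"
      unfolding img by blast
    have "D \<in> {C, flip C}" if "D \<in> ?T" "pts D = y" for D
    proof -
      obtain E where E: "E \<in> set Z" "D = E \<or> D = flip E"
        using \<open>D \<in> ?T\<close> by blast
      have "pts E = pts D"
        using E(2) pts_flip by metis
      then have "pts E \<inter> pts C \<noteq> {}"
        using that(2) C(2) metric_circle_nonempty[OF circle_surface_metric_circle[OF Z C(1)]] by simp
      then have "E = C"
        by (rule circle_surface_inj[OF Z E(1) C(1)])
      then show ?thesis
        using E(2) by blast
    qed
    then have "{D \<in> ?T. pts D = y} \<subseteq> {C, flip C}"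
      by blast
    moreover have "{C, flip C} \<subseteq> {D \<in> ?T. pts D = y}"
      using C by simp
    ultimately have "{D \<in> ?T. pts D = y} = {C, flip C}"
      by (rule antisym)
    then show "card {D \<in> ?T. pts D = y} = 2"
      using flip_neq[OF circle_surface_metric_circle[OF Z C(1)]] by simp
  qed (use k in auto)
  then have "real (card {\<tau>. length \<tau> = k \<and> set \<tau> \<subseteq> ?T \<and> distinct (map pts \<tau>)} * fact (length Z - k)) =
      real (2 ^ k * fact (length Z))"
    by (rule arg_cong)
  then have "real (card {\<tau>. length \<tau> = k \<and> set \<tau> \<subseteq> ?T \<and> distinct (map pts \<tau>)}) * fact (length Z - k) =
      2 ^ k * fact (length Z)"
    by (simp only: of_nat_fact of_nat_mult of_nat_numeral of_nat_power)
  ultimately show ?thesis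
    by (simp add: field_simps)
qed

lemma sub_csurfaces_length:
  assumes Z: "circle_surface Z" and \<tau>: "\<tau> \<in> sub_csurfaces Z"
  shows "length \<tau> \<in> {1..length Z}"
proof -
  have \<tau>: "\<tau> \<noteq> []" "set \<tau> \<subseteq> set Z \<union> flip ` set Z" "distinct (map pts \<tau>)"
    using \<tau> by (auto simp: sub_csurfaces_circles[OF Z])
  have "length \<tau> = card (pts ` set \<tau>)"
    using distinct_card[OF \<tau>(3)] by simp
  also have "\<dots> \<le> card (pts ` set Z)"
    using \<tau>(2) by (intro card_mono) auto
  also have "\<dots> \<le> length Z"
    using card_image_le[of "set Z" pts] card_length[of Z] by simp
  finally show ?thesis
    using \<tau>(1) by (simp add: Suc_le_eq)
qed

text \<open>Finiteness turns the unordered sum in \<open>moebius_function\<close> into an ordinary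
  one.\<close>

lemma finite_sub_csurfaces:
  assumes Z: "circle_surface Z"
  shows "finite (sub_csurfaces Z)"
proof (rule finite_subset)
  show "sub_csurfaces Z \<subseteq> {\<tau>. set \<tau> \<subseteq> set Z \<union> flip ` set Z \<and> length \<tau> \<le> length Z}"
    using sub_csurfaces_length[OF Z] sub_csurfaces_circles[OF Z] by auto
qed (rule finite_lists_length_le, simp)

subsection \<open>The Moebius function\<close>

text \<open>The sum rule is a linear equation whose only unknown is the value at full length. The
  actual and the claimed values both satisfy it and differ at most in that length, whose coefficient
  is not zero.\<close>

lemma moebius_short_circles:
  assumes \<mu>: "moebius_function \<kappa> R \<mu>" and "circle_surface Z"
    and "\<forall>C\<in>set Z. geodesic_length (cdist C) (pts C) \<le> \<kappa>"
  shows "\<mu> (cs_class Z) = (- 1) ^ (length Z + 1) / (2 ^ length Z * fact (length Z))"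
  using assms(2,3)
proof (induction "length Z" arbitrary: Z rule: less_induct)
  case less
  note Z = \<open>circle_surface Z\<close>
  define q where "q = length Z"
  \<comment> \<open>\<open>w\<close> lists the claimed values by length and \<open>v\<close> the
    actual ones, with the induction hypothesis inserted for lengths below \<open>q\<close>.\<close>
  define w :: "nat \<Rightarrow> real" where "w = (\<lambda>k. (- 1) ^ (k + 1) / (2 ^ k * fact k))"
  define v where "v = (\<lambda>k. if k = q then \<mu> (cs_class Z) else w k)"
  define N where "N = (\<lambda>k. real (card {\<tau> \<in> sub_csurfaces Z. length \<tau> = k}))"
  have q: "q \<ge> 1"
    using circle_surface_nonempty[OF Z] by (simp add: q_def Suc_le_eq)
  have N: "N k = 2 ^ k * fact q / fact (q - k)" if "k \<in> {1..q}" for k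
    using card_sub_csurfaces[OF Z, of k] that by (simp add: N_def q_def)
  have \<mu>_eq: "\<mu> (cs_class \<tau>) = v (length \<tau>)" if \<tau>: "\<tau> \<in> sub_csurfaces Z" for \<tau>
  proof (cases "length \<tau> = q")
    case True
    \<comment> \<open>At full length \<tau> differs from \<open>Z\<close> only by the order and the
      orientations, which the invariance of \<mu> ignores.\<close>
    have "\<mu> (cs_class \<tau>) = \<mu> (cs_class Z)"
      using \<mu> diffeo_related_circles[OF Z \<tau>] True circle_surface_c_surface Z
        circle_surface_sub_csurfaces[OF Z \<tau>] unfolding moebius_function_def q_def by blast
    then show ?thesis
      using True by (simp add: v_def)
  next
    case False
    have "length \<tau> < length Z"
      using sub_csurfaces_length[OF Z \<tau>] False by (simp add: q_def)
    moreover have "\<forall>C\<in>set \<tau>. geodesic_length (cdist C) (pts C) \<le> \<kappa>"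
      using less.prems(2) \<tau> by (auto simp: sub_csurfaces_circles[OF Z])
    ultimately show ?thesis
      using less.hyps circle_surface_sub_csurfaces[OF Z \<tau>] False by (simp add: v_def w_def)
  qed
  have "((\<lambda>\<tau>. \<mu> (cs_class \<tau>)) has_sum 1) (sub_csurfaces Z)"
    using \<mu> circle_surface_c_surface[OF Z] less.prems(2)
    unfolding moebius_function_def derived_tangles_circles_iff[OF Z, of \<kappa> R, symmetric] by blast
  then have "1 = (\<Sum>\<tau>\<in>sub_csurfaces Z. \<mu> (cs_class \<tau>))"
    using finite_sub_csurfaces[OF Z] by (simp add: has_sum_finite_iff)
  also have "\<dots> = (\<Sum>\<tau>\<in>sub_csurfaces Z. v (length \<tau>))"
    using \<mu>_eq by (rule sum.cong[OF refl])
  also have "\<dots> = (\<Sum>k=1..q. \<Sum>\<tau>\<in>{\<tau> \<in> sub_csurfaces Z. length \<tau> = k}. v (length \<tau>))"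
    using sub_csurfaces_length[OF Z] finite_sub_csurfaces[OF Z]
    by (intro sum.group[symmetric]) (auto simp: q_def)
  also have "\<dots> = (\<Sum>k=1..q. N k * v k)"
    by (simp add: N_def)
  finally have 1: "(\<Sum>k=1..q. N k * v k) = 1" ..
  have "N k * w k = (- 1) ^ (k + 1) * real (q choose k)" if "k \<in> {1..q}" for k
    using that by (simp add: N w_def binomial_fact field_simps)
  then have "(\<Sum>k=1..q. N k * w k) = 1"
    using alternating_binomial_sum[OF q] by simp
  then have "(\<Sum>k=1..q. N k * (v k - w k)) = 0"
    using 1 by (simp add: right_diff_distrib sum_subtractf)
  also have "(\<Sum>k=1..q. N k * (v k - w k)) = (\<Sum>k\<in>{q}. N k * (v k - w k))"
    using q by (intro sum.mono_neutral_right) (auto simp: v_def)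
  finally have "v q = w q"
    using N[of q] q by simp
  then show ?case
    by (simp add: v_def w_def q_def)
qed

theorem proposition3p2:
  fixes \<kappa> R :: real and \<mu> :: "csurface set \<Rightarrow> real" and q :: nat and Z :: csurface
  assumes "0 < \<kappa>" and "\<kappa> < R" and "\<kappa> < 2 * arsinh 1"
    and "moebius_function \<kappa> R \<mu>"
    and "q \<ge> 1"
    and "c_surface Z" and "signature Z = replicate q (0, 2)"
  shows "\<mu> (cs_class Z) =
    (- 1) ^ (q + 1) / (2 ^ q * fact q) *
    (\<Prod>i<q. indicator {0..\<kappa>} (geodesic_length (cdist (Z ! i)) (pts (Z ! i))))"
proof -
  let ?len = "\<lambda>C. geodesic_length (cdist C) (pts C)"
  have Z: "circle_surface Z" and q: "length Z = q"
    using circle_surface_if_signature assms(6,7) by auto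
  \<comment> \<open>Positivity reduces membership in \<open>{0..\<kappa>}\<close> to the upper
    bound.\<close>
  have len_pos: "?len C > 0" if "C \<in> set Z" for C
    using that circle_surface_metric_circle[OF Z] by (intro geodesic_length_pos)
  show ?thesis
  proof (cases "\<forall>C\<in>set Z. ?len C \<le> \<kappa>")
    case True
    have "indicator {0..\<kappa>} (?len (Z ! i)) = (1 :: real)" if "i < q" for i
    proof -
      have "Z ! i \<in> set Z"
        using that q by simp
      then show ?thesis
        using True len_pos by (simp add: indicator_def less_imp_le)
    qed
    then have "(\<Prod>i<q. indicator {0..\<kappa>} (?len (Z ! i))) = (1 :: real)"
      by simp
    then show ?thesis
      using moebius_short_circles[OF assms(4) Z True] q by simp
  next
    case False
    then obtain i where i: "i < q" "?len (Z ! i) > \<kappa>"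
      using q by (auto simp: in_set_conv_nth not_le)
    then have "(\<Prod>i<q. indicator {0..\<kappa>} (?len (Z ! i))) = (0 :: real)"
      by (intro prod_zero) (auto intro!: bexI[of _ i])
    \<comment> \<open>The vanishing of \<mu> off the derived tangles is imposed only on
      \<open>big_moduli\<close>.\<close>
    moreover have "cs_class Z \<in> big_moduli"
      using assms(5,6) q unfolding big_moduli_def moduli_def c_surface_def by auto
    then have "\<mu> (cs_class Z) = 0"
      using assms(4) False derived_tangles_circles_iff[OF Z] unfolding moebius_function_def by blast
    ultimately show ?thesis
      by simp
  qed
qed

end
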